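(* Let $k,s$ be positive integers and let $\mathbf{b}=(b_1,\dots,b_k)$ be a $k$-tuple of positive integers with $b_i\neq b_j$ for $i\neq j$. Then $AP(\mathbf{b};s)$ has the universal pattern property and both the residue and non-residue support properties. Moreover, if $b=\max_i b_i$, $$\gamma=\Big|\bigcup_{j=1}^{k}\{ib_j: i\in[0,s-1]\}\Big|,$$ $\varepsilon$ is a choice of signs for $[1,\gamma]$, and, for odd primes $p$, $$c_\varepsilon(p)=\big|\{S\in AP(\mathbf{b};s)\cap 2^{[1,p-1]}: (S,\varepsilon,p)\text{ is a residue pattern of }p\}\big|,$$ $$c_\sigma(p)=\big|\{S\in AP(\mathbf{b};s)\cap 2^{[1,p-1]}: S\text{ is a residue (respectively, non-residue) support set of }p\}\big|,$$ then as $p\to+\infty$ (through the odd primes), $$c_\varepsilon(p)\sim 2^{-\gamma}p\quad\text{and}\quad c_\sigma(p)\sim 2^{-(1+b(s-1))}p,$$ the latter holding both for residue support sets and for non-residue support sets.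
   Context: Notation: $[m,n]$ is the set of integers $x$ with $m\le x\le n$, and $[m,+\infty)$ the set of integers $\geq m$; $2^A$ is the set of all subsets of $A$. Throughout $p$ denotes an odd prime and $\chi_p$ the Legendre symbol modulo $p$ (with $\chi_p(x)=0$ if $p\mid x$). $R(p)$ (respectively $NR(p)$) is the set of quadratic residues (respectively non-residues) of $p$ in $[1,p-1]$. For real sequences indexed by odd primes, $a(p)\sim b(p)$ means $a(p)/b(p)\to1$ as $p\to+\infty$. For $\mathbf{b}=(b_1,\dots,b_k)$ with distinct positive integer coordinates and $s\ge1$, $$AP(\mathbf{b};s)=\Big\{\bigcup_{j=1}^{k}\{n+ib_j:i\in[0,s-1]\}:n\in[1,+\infty)\Big\}.$$ For a nonempty finite set $Z=\{z_1<\dots<z_r\}\subseteq[0,+\infty)$ let $\mathcal{S}(Z)=\{\{n+z_i:i\in[1,r]\}:n\in[1,+\infty)\}$. Note that $AP(\mathbf{b};s)=\mathcal{S}(Z)$ with $Z=\bigcup_{j=1}^{k}\{ib_j:i\in[0,s-1]\}$, and the definitions below are applied with this $Z$ (so $r=\gamma$). A choice of signs for $[1,r]$ is a function $\varepsilon:[1,r]\to\{-1,1\}$. For $S=\{n+z_i:i\in[1,r]\}\in\mathcal{S}(Z)$, the triple $(S,\varepsilon,p)$ is a residue pattern of $p$ if $\chi_p(n+z_i)=\varepsilon(i)$ for all $i\in[1,r]$. $\mathcal{S}(Z)$ has the universal pattern property if there is $p_0>0$ such that for all $p\ge p_0$ and all choices of signs $\varepsilon$ for $[1,r]$ there is $S\in\mathcal{S}(Z)\cap2^{[1,p-1]}$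 such that $(S,\varepsilon,p)$ is a residue pattern of $p$. A set $S$ is a residue (respectively non-residue) support set of $p$ if $S=R(p)\cap[\min S,\max S]$ (respectively $S=NR(p)\cap[\min S,\max S]$). $\mathcal{S}(Z)$ has the residue (respectively non-residue) support property if there is $p_0>0$ such that for all $p\ge p_0$ there is $S\in\mathcal{S}(Z)\cap2^{[1,p-1]}$ that is a residue (respectively non-residue) support set of $p$. *)

theory Defs
  imports "HOL-Number_Theory.Number_Theory" "HOL-Library.Landau_Symbols"
begin

definition quad_residues :: "nat \<Rightarrow> nat set" where
  "quad_residues p = {x \<in> {1..p - 1}. QuadRes (int p) (int x)}"

definition quad_nonresidues :: "nat \<Rightarrow> nat set" where
  "quad_nonresidues p = {x \<in> {1..p - 1}. \<not> QuadRes (int p) (int x)}"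

text \<open>The family of all translates of \<open>Z\<close> by positive integers.\<close>

definition translates :: "nat set \<Rightarrow> nat set set" where
  "translates Z = {(\<lambda>z. n + z) ` Z | n. n \<ge> 1}"

text \<open>The tuple \<open>b\<close> is given by its values on \<open>{1..k}\<close>; the definitions below are used for \<open>s \<ge> 1\<close>.\<close>

definition AP_base :: "nat \<Rightarrow> (nat \<Rightarrow> nat) \<Rightarrow> nat \<Rightarrow> nat set" where
  "AP_base k b s = (\<Union>j\<in>{1..k}. {i * b j | i. i \<in> {0..s - 1}})"

definition AP :: "nat \<Rightarrow> (nat \<Rightarrow> nat) \<Rightarrow> nat \<Rightarrow> nat set set" where
  "AP k b s = {(\<Union>j\<in>{1..k}. {n + i * b j | i. i \<in> {0..s - 1}}) | n. n \<ge> 1}"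

lemma AP_eq_translates: "AP k b s = translates (AP_base k b s)"
proof -
  have "(\<Union>j\<in>{1..k}. {n + i * b j | i. i \<in> {0..s - 1}}) = (\<lambda>z. n + z) ` AP_base k b s" for n
    unfolding AP_base_def by blast
  then show ?thesis
    unfolding AP_def translates_def by simp
qed

text \<open>The \<open>i\<close>-th smallest element of a finite set, for \<open>i\<close> counted from 1.\<close>

definition nth_elem :: "nat set \<Rightarrow> nat \<Rightarrow> nat" where
  "nth_elem Z i = sorted_list_of_set Z ! (i - 1)"

definition sign_choices :: "nat \<Rightarrow> (nat \<Rightarrow> int) set" where
  "sign_choices r = ({1..r} \<rightarrow> {-1, 1})"

text \<open>
  \<open>residue_pattern Z S \<epsilon> p\<close>: the member \<open>S = n + Z\<close> of \<open>translates Z\<close> realises the signs \<open>\<epsilon>\<close>.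
  For finite nonempty \<open>Z\<close> the shift \<open>n\<close> is uniquely determined by \<open>S\<close>.
\<close>

definition residue_pattern :: "nat set \<Rightarrow> nat set \<Rightarrow> (nat \<Rightarrow> int) \<Rightarrow> nat \<Rightarrow> bool" where
  "residue_pattern Z S \<epsilon> p \<longleftrightarrow>
     (\<exists>n\<ge>1. S = (\<lambda>z. n + z) ` Z \<and>
        (\<forall>i\<in>{1..card Z}. Legendre (int (n + nth_elem Z i)) (int p) = \<epsilon> i))"

text \<open>The next property is a property of the family \<open>translates Z\<close>, which determines \<open>Z\<close>.\<close>

definition universal_pattern_property :: "nat set \<Rightarrow> bool" where
  "universal_pattern_property Z \<longleftrightarrow>
     (\<exists>p0>0. \<forall>p\<ge>p0. prime p \<and> odd p \<longrightarrow>
        (\<forall>\<epsilon>\<in>sign_choices (card Z).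
           \<exists>S \<in> translates Z \<inter> Pow {1..p - 1}. residue_pattern Z S \<epsilon> p))"

text \<open>Support sets are only considered for finite nonempty \<open>S\<close>.\<close>

definition residue_support_set :: "nat \<Rightarrow> nat set \<Rightarrow> bool" where
  "residue_support_set p S \<longleftrightarrow> S = quad_residues p \<inter> {Min S..Max S}"

definition nonresidue_support_set :: "nat \<Rightarrow> nat set \<Rightarrow> bool" where
  "nonresidue_support_set p S \<longleftrightarrow> S = quad_nonresidues p \<inter> {Min S..Max S}"

definition residue_support_property :: "nat set set \<Rightarrow> bool" where
  "residue_support_property \<S> \<longleftrightarrow>
     (\<exists>p0>0. \<forall>p\<ge>p0. prime p \<and> odd p \<longrightarrow>
        (\<exists>S \<in> \<S> \<inter> Pow {1..p - 1}. residue_support_set p S))"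

definition nonresidue_support_property :: "nat set set \<Rightarrow> bool" where
  "nonresidue_support_property \<S> \<longleftrightarrow>
     (\<exists>p0>0. \<forall>p\<ge>p0. prime p \<and> odd p \<longrightarrow>
        (\<exists>S \<in> \<S> \<inter> Pow {1..p - 1}. nonresidue_support_set p S))"

definition at_top_odd_primes :: "nat filter" where
  "at_top_odd_primes = inf at_top (principal {p. prime p \<and> odd p})"

end

theory Submission
  imports Defs "HOL-Computational_Algebra.Polynomial"
begin

text \<open>
  A sign pattern on \<open>n + W\<close> is detected by the product of \<open>1 + \<epsilon> w * \<chi> (n + w)\<close> over \<open>w \<in> W\<close>,
  which is \<open>2 ^ card W\<close> or \<open>0\<close>. Expanding it and summing over \<open>n\<close>, the empty subset of \<open>W\<close> contributes
  the main term \<open>p\<close>, and it remains to see that for nonempty \<open>T\<close> the sum of \<open>\<chi>\<close> over the values of \<open>f = (\<Prod>w\<in>T. X + w)\<close> is \<open>o(p)\<close>.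
  This is weaker than Weil's bound, and Stepanov's method gives it with a multiplicity
  that stays fixed as \<open>p\<close> grows: a nonzero polynomial of degree about \<open>t p\<close> that vanishes
  to order \<open>2 t\<close> wherever \<open>f ^ ((p - 1) / 2)\<close> takes the value \<open>e\<close> shows that \<open>\<chi> (f x) = e\<close> for at most
  \<open>p / 2 + O(p / t)\<close> residues, for both \<open>e = 1\<close> and \<open>e = -1\<close>.
  A support set \<open>n + Z\<close> is a sign pattern on the whole interval from \<open>n\<close> to \<open>n + Max Z\<close>.

  Polynomials over the field with \<open>p\<close> elements are represented by integer polynomials, and
  vanishing modulo \<open>p\<close> by divisibility by the constant polynomial \<open>[:p:]\<close>.
\<close>

subsection \<open>Linear systems and multiplicities modulo a prime\<close>

lemma not_dvd_int_between: "\<not> m dvd x" if "x \<noteq> 0" "\<bar>x\<bar> < m" for m x :: int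
  using that by (metis zdvd_not_zless dvd_abs_iff zero_less_abs_iff)

text \<open>A pigeonhole count replaces linear algebra: there are \<open>p ^ card I\<close> vectors
  with entries in \<open>{0..<p}\<close> but only \<open>p ^ card K\<close> possible tuples of
  values modulo \<open>p\<close>, so two vectors collide. Their difference lies in the kernel, and
  it is nonzero modulo \<open>p\<close> because distinct entries differ by less than
  \<open>p\<close>.\<close>

lemma nontrivial_kernel_mod:
  fixes p :: nat and L :: "'k \<Rightarrow> ('i \<Rightarrow> int) \<Rightarrow> int"
  assumes "finite I" "finite K" "card K < card I" "p > 1"
    and diff: "\<And>x y k. k \<in> K \<Longrightarrow> L k (\<lambda>i. x i - y i) = L k x - L k y"
  obtains x where "\<exists>i\<in>I. \<not> int p dvd x i" "\<And>k. k \<in> K \<Longrightarrow> int p dvd L k x"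
proof -
  let ?A = "I \<rightarrow>\<^sub>E {0..<int p}" and ?B = "K \<rightarrow>\<^sub>E {0..<int p}"
  define \<Phi> where "\<Phi> x = (\<lambda>k\<in>K. L k x mod int p)" for x
  have "\<Phi> ` ?A \<subseteq> ?B"
    using \<open>p > 1\<close> by (auto simp: \<Phi>_def)
  then have "card (\<Phi> ` ?A) \<le> card ?B"
    using \<open>finite K\<close> by (intro card_mono finite_PiE) auto
  also have "\<dots> = p ^ card K"
    using \<open>finite K\<close> by (simp add: card_PiE)
  also have "\<dots> < p ^ card I"
    using assms by (simp add: power_strict_increasing)
  also have "\<dots> = card ?A"
    using \<open>finite I\<close> by (simp add: card_PiE)
  finally have "\<not> inj_on \<Phi> ?A"
    by (rule pigeonhole)
  then obtain x y where xy: "x \<in> ?A" "y \<in> ?A" "x \<noteq> y" "\<Phi> x = \<Phi> y"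
    by (auto simp: inj_on_def)
  show thesis
  proof
    obtain i where i: "i \<in> I" "x i \<noteq> y i"
      using xy by (meson PiE_ext)
    then have "\<bar>x i - y i\<bar> < int p" "x i - y i \<noteq> 0"
      using xy by (fastforce simp: PiE_iff abs_less_iff)+
    then show "\<exists>i\<in>I. \<not> int p dvd x i - y i"
      using i(1) not_dvd_int_between by blast
    show "int p dvd L k (\<lambda>i. x i - y i)" if "k \<in> K" for k
    proof -
      have "L k x mod int p = L k y mod int p"
        using fun_cong[OF xy(4), of k] that by (simp add: \<Phi>_def)
      then show ?thesis
        using that by (simp add: diff mod_eq_dvd_iff)
    qed
  qed
qed

section \<open>Derivatives and zeros of integer polynomials modulo \<open>p\<close>\<close>

lemma const_dvd_imp_dvd_poly:
  fixes q :: "'a :: comm_ring_1 poly"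
  shows "[:c:] dvd q \<Longrightarrow> c dvd poly q x"
  by (metis dvdE dvd_triv_left add.right_neutral poly_mult poly_pCons poly_0 mult_zero_right)

lemma const_dvd_pderiv: "[:c:] dvd q \<Longrightarrow> [:c:] dvd pderiv q"
  for c :: int
  by (auto simp: const_poly_dvd_iff coeff_pderiv)

lemma funpow_pderiv_add: "(pderiv ^^ k) (q + r) = (pderiv ^^ k) q + (pderiv ^^ k) r"
  by (induction k) (auto simp: pderiv_add)

lemma pderiv_sum: "pderiv (sum q A) = (\<Sum>i\<in>A. pderiv (q i))"
  by (induction A rule: infinite_finite_induct) (auto simp: pderiv_add)

lemma funpow_pderiv_sum: "(pderiv ^^ k) (sum q A) = (\<Sum>i\<in>A. (pderiv ^^ k) (q i))"
  by (induction k) (auto simp: pderiv_sum)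

text \<open>In the Leibniz rule only two terms survive, since the second derivative of
  \<open>X - a\<close> is zero. At \<open>k = 0\<close> the truncated \<open>k - 1\<close> is
  harmless because its coefficient is \<open>0\<close>.\<close>

lemma funpow_pderiv_linear_mult:
  fixes a :: int
  shows "(pderiv ^^ k) ([:-a, 1:] * q)
     = [:-a, 1:] * (pderiv ^^ k) q + of_nat k * (pderiv ^^ (k - 1)) q"
proof -
  define L where "L = [:-a, 1:]"
  have "pderiv L = 1" by (simp add: L_def pderiv_pCons)
  then have "(pderiv ^^ k) (L * q) = L * (pderiv ^^ k) q + of_nat k * (pderiv ^^ (k - 1)) q"
  proof (induction k)
    case (Suc k)
    then show ?case
      by (cases k) (simp_all add: pderiv_mult pderiv_add algebra_simps)
  qed simp
  then show ?thesis by (simp only: L_def)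
qed

lemma const_dvd_funpow_pderiv: "[:c:] dvd q \<Longrightarrow> [:c:] dvd (pderiv ^^ k) q"
  for c :: int
  by (induction k) (auto intro: const_dvd_pderiv)

lemma not_const_dvd_linear: "\<not> [:p:] dvd [:-a, 1:]" if "prime p" for p :: int
  using that not_prime_unit by (auto simp: const_poly_dvd_iff intro!: exI[of _ 1])

text \<open>Induction on the total multiplicity: division by \<open>X - a\<close> costs one degree
  and one order of vanishing at \<open>a\<close>, and none at the other points. Modulo
  \<open>p\<close>, derivatives record multiplicities faithfully only up to \<open>p\<close>, whence
  the bound on \<open>l x\<close>.\<close>

lemma sum_multiplicity_le_degree_mod:
  fixes p :: int and P :: "int poly"
  assumes p: "prime p" and "finite S" "S \<subseteq> {0..<p}"
    and "\<not> [:p:] dvd P" "\<And>x. x \<in> S \<Longrightarrow> int (l x) \<le> p"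
    and "\<And>x k. x \<in> S \<Longrightarrow> k < l x \<Longrightarrow> p dvd poly ((pderiv ^^ k) P) x"
  shows "(\<Sum>x\<in>S. l x) \<le> degree P"
  using assms(4-)
proof (induction "\<Sum>x\<in>S. l x" arbitrary: l P)
  case (Suc n)
  have "\<exists>x\<in>S. l x \<noteq> 0"
    using Suc.hyps(2) \<open>finite S\<close> by (metis sum.neutral Zero_not_Suc)
  then obtain a where a: "a \<in> S" "l a > 0" by auto
  define Q where "Q = synthetic_div P a"
  have P: "P = [:-a, 1:] * Q + [:poly P a:]"
    by (simp add: Q_def synthetic_div_correct' del: mult_pCons_left)
  have pa: "p dvd poly P a"
    using Suc.prems(3)[of a 0] a by simp
  \<comment> \<open>The remainder \<open>poly P a\<close> is divisible by \<open>p\<close>, so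
    modulo \<open>p\<close> the derivatives of \<open>P\<close> are those of
    \<open>(X - a) * Q\<close>.\<close>
  have D: "[:p:] dvd (pderiv ^^ k) P - ([:-a, 1:] * (pderiv ^^ k) Q + of_nat k * (pderiv ^^ (k - 1)) Q)" for k
  proof -
    have "(pderiv ^^ k) P = (pderiv ^^ k) ([:-a, 1:] * Q) + (pderiv ^^ k) [:poly P a:]"
      by (subst P) (rule funpow_pderiv_add)
    moreover have "[:p:] dvd (pderiv ^^ k) [:poly P a:]"
      using pa by (intro const_dvd_funpow_pderiv) simp
    ultimately show ?thesis
      by (simp only: funpow_pderiv_linear_mult) simp
  qed
  have Dx: "p dvd poly ((pderiv ^^ k) P) x - ((x - a) * poly ((pderiv ^^ k) Q) x + int k * poly ((pderiv ^^ (k - 1)) Q) x)" for k x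
    using const_dvd_imp_dvd_poly[OF D[of k], of x] by (simp add: algebra_simps)
  have nQ: "\<not> [:p:] dvd Q"
  proof
    assume "[:p:] dvd Q"
    then have "[:p:] dvd [:-a, 1:] * Q + [:poly P a:]"
      using pa by (intro dvd_add dvd_mult) auto
    then show False
      using Suc.prems(1) P by metis
  qed
  have "degree P \<noteq> 0"
  proof
    assume "degree P = 0"
    then have "Q = 0"
      by (simp add: Q_def synthetic_div_eq_0_iff)
    then show False using nQ by simp
  qed
  then have deg: "degree P = Suc (degree Q)"
    by (simp add: Q_def degree_synthetic_div)
  define l' where "l' = l(a := l a - 1)"
  have sum: "n = (\<Sum>x\<in>S. l' x)"
  proof -
    have "(\<Sum>x\<in>S. l x) = l a + (\<Sum>x\<in>S-{a}. l x)"
      using a \<open>finite S\<close> by (simp add: sum.remove)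
    moreover have "(\<Sum>x\<in>S. l' x) = l' a + (\<Sum>x\<in>S-{a}. l' x)"
      using a \<open>finite S\<close> by (simp add: sum.remove)
    moreover have "(\<Sum>x\<in>S-{a}. l' x) = (\<Sum>x\<in>S-{a}. l x)"
      by (rule sum.cong) (auto simp: l'_def)
    ultimately show ?thesis
      using Suc.hyps(2) a by (simp add: l'_def)
  qed
  have "(\<Sum>x\<in>S. l' x) \<le> degree Q"
  proof (rule Suc.hyps(1)[OF sum nQ])
    show "int (l' x) \<le> p" if "x \<in> S" for x
      using Suc.prems(2)[OF that] by (auto simp: l'_def)
    show "p dvd poly ((pderiv ^^ k) Q) x" if x: "x \<in> S" and k: "k < l' x" for x k
    proof (cases "x = a")
      case True
      \<comment> \<open>At \<open>a\<close> the term with the factor \<open>x - a\<close>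
        disappears, leaving \<open>Suc k\<close> times the \<open>k\<close>-th derivative of
        \<open>Q\<close>; \<open>Suc k < l a \<le> p\<close> makes that factor invertible.\<close>
      have k: "Suc k < l a" using k True by (simp add: l'_def)
      have "p dvd poly ((pderiv ^^ Suc k) P) a"
        using Suc.prems(3)[of a "Suc k"] a k by blast
      then have "p dvd int (Suc k) * poly ((pderiv ^^ k) Q) a"
        using Dx[of "Suc k" a] by (simp add: dvd_diff_right_iff del: funpow.simps of_nat_Suc)
      moreover have "\<not> p dvd int (Suc k)"
        using k Suc.prems(2)[OF a(1)] by (intro zdvd_not_zless) auto
      ultimately show ?thesis
        using p True by (simp add: prime_dvd_mult_iff del: of_nat_Suc)
    next
      case False
      have "\<bar>x - a\<bar> < p" "x - a \<noteq> 0"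
        using subsetD[OF assms(3) x] subsetD[OF assms(3) a(1)] False by (auto simp: abs_less_iff)
      then have xa: "\<not> p dvd x - a"
        using not_dvd_int_between by blast
      \<comment> \<open>Away from \<open>a\<close> the lower-order term is known to vanish by
        induction on \<open>k\<close>, and \<open>x - a\<close> can be cancelled.\<close>
      show ?thesis
        using k
      proof (induction k)
        case (Suc j)
        then have "p dvd poly ((pderiv ^^ j) Q) x" by simp
        moreover have "p dvd poly ((pderiv ^^ Suc j) P) x"
          using Suc.prems(1) Suc_lessD x False \<open>\<And>x k. x \<in> S \<Longrightarrow> k < l x \<Longrightarrow> p dvd poly ((pderiv ^^ k) P) x\<close>
          by (metis fun_upd_apply l'_def)
        ultimately have "p dvd (x - a) * poly ((pderiv ^^ Suc j) Q) x"
          using Dx[of "Suc j" x]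
          by (simp add: dvd_diff_right_iff dvd_add_left_iff del: funpow.simps of_nat_Suc)
        then show ?case
          using xa p by (simp add: prime_dvd_mult_iff del: funpow.simps)
      next
        case 0
        then have "p dvd poly P x"
          using Suc.prems(3)[of x 0] x False by (simp add: l'_def)
        then have "p dvd (x - a) * poly Q x"
          using Dx[of 0 x] by (simp add: dvd_diff_right_iff)
        then show ?case
          using xa p by (simp add: prime_dvd_mult_iff)
      qed
    qed
  qed
  then show ?case
    using Suc.hyps(2) sum deg by simp
qed simp

subsection \<open>Non-vanishing of the auxiliary polynomial\<close>

lemma freshmans_dream_mod:
  fixes u v :: "int poly"
  assumes "prime p"
  shows "[:int p:] dvd (u + v) ^ p - (u ^ p + v ^ p)"
proof -
  let ?t = "\<lambda>k. of_nat (p choose k) * u ^ k * v ^ (p - k)"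
  have "p > 0" using assms prime_gt_0_nat by blast
  have "(u + v) ^ p = (\<Sum>k\<le>p. ?t k)"
    by (rule binomial_ring)
  also have "{..p} = insert 0 (insert p {0<..<p})"
    using \<open>p > 0\<close> by auto
  also have "(\<Sum>k\<in>\<dots>. ?t k) = u ^ p + v ^ p + (\<Sum>k\<in>{0<..<p}. ?t k)"
    using \<open>p > 0\<close> by simp
  finally have "(u + v) ^ p - (u ^ p + v ^ p) = (\<Sum>k\<in>{0<..<p}. ?t k)"
    by simp
  moreover have "[:int p:] dvd ?t k" if "k \<in> {0<..<p}" for k
  proof -
    have "p dvd (p choose k)"
      by (rule dvd_choose_prime) (use that assms in auto)
    then have "[:int p:] dvd of_nat (p choose k)"
      by (simp add: of_nat_poly)
    then show ?thesis by simp
  qed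
  ultimately show ?thesis
    by (metis (no_types, lifting) dvd_sum)
qed

lemma fermat_int:
  assumes "prime p"
  shows "int p dvd a ^ p - a"
proof (cases "int p dvd a")
  case True
  then show ?thesis
    using assms prime_gt_0_nat by (simp add: dvd_diff dvd_power_same dvd_trans[OF _ dvd_power[of p a]])
next
  case False
  define b where "b = nat (a mod int p)"
  have "p > 0" using assms prime_gt_0_nat by blast
  then have b: "int b = a mod int p" by (simp add: b_def)
  then have ab: "[a = int b] (mod int p)" by (simp add: cong_def)
  have "\<not> p dvd b" using False b by (metis dvd_mod_iff int_dvd_int_iff dvd_refl)
  then have "[b ^ (p - 1) = 1] (mod p)" by (rule fermat_theorem[OF assms])
  then have "[b ^ (p - 1) * b = 1 * b] (mod p)" by (rule cong_scalar_right)
  then have "[b ^ p = b] (mod p)"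
    using \<open>p > 0\<close> by (simp only: power_minus_mult mult_1)
  then have "[int b ^ p = int b] (mod int p)"
    by (metis cong_int_iff of_nat_power)
  then have "[a ^ p = a] (mod int p)"
    using ab by (meson cong_pow cong_sym cong_trans)
  then show ?thesis by (simp add: cong_iff_dvd_diff)
qed

text \<open>Write \<open>f = f(0) + X g\<close>. The Frobenius identity and Fermat's theorem give
  \<open>f ^ p = f(0) + X ^ p * g ^ p\<close> modulo \<open>p\<close>. The purpose is that
  \<open>f ^ p\<close> becomes a constant modulo \<open>X ^ p\<close>, so \<open>W\<close> can stay
  unspecified.\<close>

lemma power_prime_mod_monom:
  fixes f :: "int poly"
  assumes "prime p"
  obtains W where "[:int p:] dvd f ^ p - ([:poly f 0:] + Polynomial.monom 1 p * W)"
proof -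
  define u where "u = [:poly f 0:]"
  define v where "v = [:0, 1:] * synthetic_div f 0"
  have f: "f = u + v"
    using synthetic_div_correct'[of 0 f] by (simp add: u_def v_def)
  have "v ^ p = Polynomial.monom 1 p * synthetic_div f 0 ^ p"
    unfolding v_def by (simp add: power_mult_distrib monom_altdef del: mult_pCons_left)
  moreover have "[:int p:] dvd u ^ p - [:poly f 0:]"
    using fermat_int[OF assms, of "poly f 0"] by (simp add: u_def poly_const_pow)
  then have "[:int p:] dvd (f ^ p - (u ^ p + v ^ p)) + (u ^ p - [:poly f 0:])"
    using freshmans_dream_mod[OF assms, of u v] f by (intro dvd_add) auto
  moreover have "(f ^ p - (u ^ p + v ^ p)) + (u ^ p - [:poly f 0:]) = f ^ p - ([:poly f 0:] + v ^ p)"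
    by (simp only: algebra_simps)
  ultimately show thesis
    by (metis that)
qed

lemma const_dvd_low_degree:
  fixes A :: "int poly"
  assumes "[:p:] dvd A - Polynomial.monom 1 n * W" "degree A < n"
  shows "[:p:] dvd A"
  unfolding const_poly_dvd_iff
proof
  fix i
  show "p dvd poly.coeff A i"
  proof (cases "i < n")
    case True
    then show ?thesis
      using assms(1) by (auto simp: const_poly_dvd_iff coeff_monom_mult dest!: spec[of _ i])
  qed (use assms(2) in \<open>simp add: coeff_eq_0\<close>)
qed

text \<open>Modulo \<open>p\<close>, the first term has odd order at \<open>a\<close> and the second even order, so both vanish.\<close>

lemma odd_order_eq_even_order_mod:
  fixes r s f :: "int poly"
  assumes p: "prime (p :: int)" and f: "\<not> p dvd poly f a" and c: "\<not> p dvd c"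
    and "[:p:] dvd r ^ 2 * ([:-a, 1:] * f) - [:c:] * s ^ 2"
  shows "[:p:] dvd r \<and> [:p:] dvd s"
proof -
  have pp: "prime_elem [:p:]" using p by (simp only: prime_elem_const_poly_iff prime_imp_prime_elem)
  \<comment> \<open>Infinite descent on the degree bound \<open>N\<close>, dividing \<open>r\<close>
    and \<open>s\<close> by \<open>X - a\<close> in each round. The disjuncts for the zero
    polynomial let \<open>N = 0\<close> mean \<open>r = s = 0\<close>.\<close>
  have main: "[:p:] dvd r \<and> [:p:] dvd s"
    if "r = 0 \<or> degree r < N" "s = 0 \<or> degree s < N"
      and "[:p:] dvd r ^ 2 * ([:-a, 1:] * f) - [:c:] * s ^ 2" for N r s
    using that
  proof (induction N arbitrary: r s)
    case (Suc N)
    define L where "L = [:-a, 1:]"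
    define r' where "r' = synthetic_div r a"
    define s' where "s' = synthetic_div s a"
    have r: "r = L * r' + [:poly r a:]" and s: "s = L * s' + [:poly s a:]"
      by (simp_all add: L_def r'_def s'_def synthetic_div_correct' del: mult_pCons_left)
    have La: "poly L a = 0" by (simp add: L_def)
    have cancel: "[:p:] dvd q" if "[:p:] dvd L * q" for q
      using that pp not_const_dvd_linear[OF p, of a] by (simp add: prime_elem_dvd_mult_iff L_def del: mult_pCons_left)
    have 1: "[:p:] dvd r ^ 2 * (L * f) - [:c:] * s ^ 2"
      using Suc.prems(3) by (simp add: L_def)
    \<comment> \<open>Evaluation at \<open>a\<close> removes the term containing \<open>L\<close>,
      so \<open>p\<close> divides \<open>s(a)\<close>. Then \<open>s\<close> may be replaced by
      \<open>L * s'\<close> and one \<open>L\<close> cancelled; a second evaluation gives the same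
      for \<open>r\<close>, and the second cancellation restores the original shape with
      \<open>r'\<close> and \<open>s'\<close>.\<close>
    have "p dvd c * poly s a ^ 2"
      using const_dvd_imp_dvd_poly[OF 1, of a] La by simp
    then have "p dvd poly s a"
      using p c by (simp add: prime_dvd_mult_iff prime_dvd_power_iff)
    then have sd: "[:p:] dvd [:poly s a:]" by simp
    define e where "e = [:poly s a:]"
    have "[:p:] dvd (r ^ 2 * (L * f) - [:c:] * s ^ 2) + e * ([:c:] * (2 * (L * s') + e))"
      using 1 sd unfolding e_def by (intro dvd_add dvd_mult2) auto
    also have "\<dots> = L * (r ^ 2 * f - [:c:] * (L * s' ^ 2))"
      by (subst s, fold e_def) (simp add: algebra_simps power2_eq_square del: mult_pCons_left mult_pCons_right)
    finally have 2: "[:p:] dvd r ^ 2 * f - [:c:] * (L * s' ^ 2)"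
      by (rule cancel)
    have "p dvd poly r a ^ 2 * poly f a"
      using const_dvd_imp_dvd_poly[OF 2, of a] La by simp
    then have "p dvd poly r a"
      using p f by (simp add: prime_dvd_mult_iff prime_dvd_power_iff)
    then have rd: "[:p:] dvd [:poly r a:]" by simp
    define d where "d = [:poly r a:]"
    have "[:p:] dvd (r ^ 2 * f - [:c:] * (L * s' ^ 2)) - d * (f * (2 * (L * r') + d))"
      by (rule dvd_diff[OF 2 dvd_mult2[OF rd[folded d_def]]])
    also have "\<dots> = L * (r' ^ 2 * (L * f) - [:c:] * s' ^ 2)"
      by (subst r, fold d_def) (simp add: algebra_simps power2_eq_square del: mult_pCons_left mult_pCons_right)
    finally have 3: "[:p:] dvd r' ^ 2 * ([:-a, 1:] * f) - [:c:] * s' ^ 2"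
      unfolding L_def by (rule cancel[unfolded L_def])
    have dr: "r' = 0 \<or> degree r' < N"
      using Suc.prems(1) by (cases "degree r = 0") (auto simp: r'_def synthetic_div_eq_0_iff degree_synthetic_div)
    have ds: "s' = 0 \<or> degree s' < N"
      using Suc.prems(2) by (cases "degree s = 0") (auto simp: s'_def synthetic_div_eq_0_iff degree_synthetic_div)
    have "[:p:] dvd r' \<and> [:p:] dvd s'"
      by (rule Suc.IH[OF dr ds 3])
    then show ?case
      using r s rd sd by (metis dvd_add dvd_mult)
  qed auto
  show ?thesis
    by (rule main[of r "Suc (degree r + degree s)" s]) (use assms in auto)
qed

text \<open>Multiplying \<open>r + s * f ^ h\<close> by its conjugate \<open>r - s * f ^ h\<close>
  and by \<open>f\<close> yields \<open>r ^ 2 * f - s ^ 2 * f ^ p\<close>, which is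
  \<open>r ^ 2 * f - f(0) * s ^ 2\<close> modulo \<open>p\<close> and \<open>X ^ p\<close>. Its
  degree is below \<open>p\<close>, so it vanishes modulo \<open>p\<close>; the simple zero
  \<open>a\<close> of \<open>f\<close> then gives the contradiction between odd and even
  order.\<close>

lemma const_dvd_coeffs_of_half_power_mod:
  fixes r s f :: "int poly"
  assumes p: "prime p" and h: "2 * h + 1 = p"
    and f: "f = [:-a, 1:] * f2" and a: "\<not> int p dvd poly f2 a" and f0: "\<not> int p dvd poly f 0"
    and r: "degree r \<le> D" and s: "degree s \<le> D" and D: "2 * D + degree f < p"
    and dvd: "[:int p:] dvd r + s * f ^ h - Polynomial.monom 1 p * W"
  shows "[:int p:] dvd r \<and> [:int p:] dvd s"
proof -
  define X where "X = Polynomial.monom (1::int) p"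
  obtain V where V: "[:int p:] dvd f ^ p - ([:poly f 0:] + X * V)"
    using power_prime_mod_monom[OF p] X_def by metis
  define c where "c = [:poly f 0:]"
  define A where "A = r ^ 2 * f - c * s ^ 2"
  have "[:int p:] dvd (r + s * f ^ h - X * W) * (f * (r - s * f ^ h)) + s ^ 2 * (f ^ p - (c + X * V))"
    using dvd V unfolding X_def c_def by (intro dvd_add dvd_mult dvd_mult2) auto
  also have "f ^ p = f * (f ^ h) ^ 2"
    by (simp flip: h power_mult add: mult.commute)
  also have "(r + s * f ^ h - X * W) * (f * (r - s * f ^ h)) + s ^ 2 * (f * (f ^ h) ^ 2 - (c + X * V))
      = A - X * (W * (f * (r - s * f ^ h)) + s ^ 2 * V)"
    unfolding A_def by (simp add: algebra_simps power2_eq_square)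
  finally have *: "[:int p:] dvd A - X * (W * (f * (r - s * f ^ h)) + s ^ 2 * V)" .
  have "degree (r ^ 2 * f) \<le> 2 * D + degree f"
    using r by (intro order.trans[OF degree_mult_le] add_mono order.trans[OF degree_power_le]) auto
  moreover have "degree (c * s ^ 2) \<le> 0 + 2 * D"
    using s unfolding c_def by (intro order.trans[OF degree_mult_le] add_mono order.trans[OF degree_power_le]) auto
  ultimately have "degree A < p"
    unfolding A_def using D degree_diff_le_max[of "r ^ 2 * f" "c * s ^ 2"] by auto
  then have "[:int p:] dvd A"
    using * unfolding X_def by (rule const_dvd_low_degree[rotated])
  then show ?thesis
    using odd_order_eq_even_order_mod[of "int p" f2 a "poly f 0" r s] p a f0
    unfolding A_def c_def f by (simp add: prime_nat_int_transfer)
qed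

text \<open>All blocks with \<open>j \<ge> 1\<close> are multiples of \<open>X ^ p\<close>, so the
  block \<open>j = 0\<close> falls under the previous lemma. Removing it and dividing by
  \<open>X ^ p\<close> leaves a sum with one block fewer.\<close>

lemma const_dvd_coeffs_of_stepanov_poly:
  fixes r s :: "nat \<Rightarrow> int poly"
  assumes p: "prime p" and h: "2 * h + 1 = p"
    and f: "f = [:-a, 1:] * f2" and a: "\<not> int p dvd poly f2 a" and f0: "\<not> int p dvd poly f 0"
    and "\<And>j. degree (r j) \<le> D" "\<And>j. degree (s j) \<le> D" and D: "2 * D + degree f < p"
    and "[:int p:] dvd (\<Sum>j<J. Polynomial.monom 1 (j * p) * (r j + s j * f ^ h))"
    and "j < J"
  shows "[:int p:] dvd r j \<and> [:int p:] dvd s j"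
  using assms(6,7,9,10)
proof (induction J arbitrary: j r s)
  case (Suc J)
  define X where "X = Polynomial.monom (1::int) p"
  define Q where "Q = (\<Sum>j<J. Polynomial.monom 1 (j * p) * (r (Suc j) + s (Suc j) * f ^ h))"
  have "(\<Sum>j<Suc J. Polynomial.monom 1 (j * p) * (r j + s j * f ^ h)) = r 0 + s 0 * f ^ h + X * Q"
    unfolding sum.lessThan_Suc_shift Q_def X_def
    by (simp add: sum_distrib_left mult_monom mult.assoc [symmetric])
  then have dvd: "[:int p:] dvd r 0 + s 0 * f ^ h + X * Q"
    using Suc.prems(3) by simp
  have 0: "[:int p:] dvd r 0 \<and> [:int p:] dvd s 0"
    by (rule const_dvd_coeffs_of_half_power_mod[OF p h f a f0 Suc.prems(1) Suc.prems(2) D, where W = "- Q"])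
      (use dvd in \<open>simp add: X_def\<close>)
  then have "[:int p:] dvd r 0 + s 0 * f ^ h"
    by (simp add: dvd_add dvd_mult2)
  then have "[:int p:] dvd X * Q"
    using dvd by (simp add: dvd_add_right_iff)
  then have "[:int p:] dvd Q"
    by (force simp: X_def const_poly_dvd_iff coeff_monom_mult dest: spec[of _ "_ + p"])
  then have "[:int p:] dvd r (Suc i) \<and> [:int p:] dvd s (Suc i)" if "i < J" for i
    unfolding Q_def
    by (intro Suc.IH[of "\<lambda>i. r (Suc i)" "\<lambda>i. s (Suc i)"] Suc.prems that)
  then show ?case
    using 0 Suc.prems(4) by (cases j) auto
qed simp

subsection \<open>Stepanov's bound\<close>

text \<open>\<open>twisted_deriv f c k s\<close> is the \<open>k\<close>-th derivative of \<open>f ^ c * s\<close> divided by \<open>f ^ (c - k)\<close>,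
  for \<open>k \<le> c\<close> (the subtraction \<open>c - k\<close> truncates beyond).\<close>

primrec twisted_deriv :: "int poly \<Rightarrow> nat \<Rightarrow> nat \<Rightarrow> int poly \<Rightarrow> int poly" where
  "twisted_deriv f c 0 s = s"
| "twisted_deriv f c (Suc k) s =
     f * pderiv (twisted_deriv f c k s) + of_nat (c - k) * (pderiv f * twisted_deriv f c k s)"

lemma funpow_pderiv_power_mult:
  "k \<le> c \<Longrightarrow> (pderiv ^^ k) (f ^ c * s) = f ^ (c - k) * twisted_deriv f c k s"
proof (induction k)
  case (Suc k)
  define d where "d = c - Suc k"
  have d: "c - k = Suc d" using Suc.prems by (simp add: d_def)
  have "(pderiv ^^ Suc k) (f ^ c * s) = pderiv (f ^ Suc d * twisted_deriv f c k s)"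
    using Suc d by simp
  also have "\<dots> = f ^ d * (f * pderiv (twisted_deriv f c k s) + of_nat (Suc d) * (pderiv f * twisted_deriv f c k s))"
    by (simp only: pderiv_mult pderiv_power_Suc of_nat_poly) (simp add: algebra_simps)
  finally show ?case
    using d by (simp only: twisted_deriv.simps d_def)
qed simp

lemma twisted_deriv_diff:
  "twisted_deriv f c k (r - s) = twisted_deriv f c k r - twisted_deriv f c k s"
proof (induction k)
  case (Suc k)
  show ?case
    unfolding twisted_deriv.simps Suc.IH pderiv_diff by (simp add: algebra_simps)
qed simp

lemma degree_twisted_deriv: "degree (twisted_deriv f c k s) \<le> degree s + k * degree f"
proof (induction k)
  case (Suc k)
  let ?T = "twisted_deriv f c k s"
  have "degree (f * pderiv ?T) \<le> degree f + degree ?T"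
    by (rule order.trans[OF degree_mult_le]) (simp add: degree_pderiv)
  moreover have "degree (of_nat (c - k) * (pderiv f * ?T)) \<le> 0 + (degree f + degree ?T)"
    by (intro order.trans[OF degree_mult_le] add_mono) (simp_all add: degree_pderiv)
  ultimately have "degree (twisted_deriv f c (Suc k) s) \<le> degree f + degree ?T"
    by (simp add: degree_add_le)
  then show ?case using Suc by simp
qed simp

text \<open>A polynomial whose derivative vanishes modulo \<open>c\<close> behaves like a constant
  under differentiation. The intended case is \<open>u = X ^ (j * p)\<close> with
  \<open>c = p\<close>.\<close>

lemma const_dvd_funpow_pderiv_mult:
  fixes u w :: "int poly"
  assumes "[:c:] dvd pderiv u"
  shows "[:c:] dvd (pderiv ^^ k) (u * w) - u * (pderiv ^^ k) w"
proof (induction k)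
  case (Suc k)
  have "[:c:] dvd pderiv ((pderiv ^^ k) (u * w) - u * (pderiv ^^ k) w) + pderiv u * (pderiv ^^ k) w"
    by (rule dvd_add[OF const_dvd_pderiv[OF Suc.IH] dvd_mult2[OF assms]])
  also have "\<dots> = (pderiv ^^ Suc k) (u * w) - u * (pderiv ^^ Suc k) w"
    by (simp add: pderiv_diff pderiv_mult)
  finally show ?case .
qed simp

text \<open>The auxiliary polynomial is \<open>f ^ l * (\<Sum>j<J. X ^ (j p) * (r j + s j * f ^ h))\<close> with
  \<open>degree (r j), degree (s j) \<le> D\<close>. At \<open>x \<in> S\<close> we have \<open>x ^ p = x\<close> and \<open>f x ^ h = e\<close>, so its \<open>k\<close>-th
  derivative there is a power of \<open>f x\<close> times the value of a polynomial \<open>\<sigma> k\<close> of low degree;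
  \<open>unknowns\<close> allows all \<open>\<sigma> k\<close> to be made zero by choosing \<open>r\<close> and \<open>s\<close>.\<close>

lemma stepanov_bound:
  fixes f :: "int poly" and e :: int
  assumes p: "prime p" and h: "2 * h + 1 = p"
    and f: "f = [:-a, 1:] * f2" and a: "\<not> int p dvd poly f2 a" and f0: "\<not> int p dvd poly f 0"
    and S: "S \<subseteq> {0..<int p}" and e: "\<And>x. x \<in> S \<Longrightarrow> [poly f x ^ h = e] (mod int p)"
    and D: "2 * D + degree f < p" and l: "l \<le> p"
    and unknowns: "l * (J + D + l * degree f) < 2 * J * (D + 1)"
  shows "l * card S \<le> (J - 1) * p + D + (l + h) * degree f"
proof -
  have "finite S" using S by (rule finite_subset) simp
  have pp: "prime_elem [:int p:]"
    using p by (simp add: prime_elem_const_poly_iff)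
  \<comment> \<open>For \<open>k < l\<close>, \<open>\<sigma> k\<close> has degree below
    \<open>N\<close>: at most \<open>J - 1\<close> from \<open>X ^ j\<close>, and at most
    \<open>D + l * degree f\<close> from the twisted derivatives. \<open>K\<close> indexes the
    coefficients to be killed; \<open>I\<close> indexes the unknown coefficients, with
    \<open>True\<close> for \<open>r j\<close> and \<open>False\<close> for
    \<open>s j\<close>.\<close>
  define N where "N = J + D + l * degree f"
  define I where "I = {..<J} \<times> (UNIV :: bool set) \<times> {..D}"
  define K where "K = {..<l} \<times> {..<N}"
  define R where "R x b j = (\<Sum>i\<le>D. Polynomial.monom (x (j, b, i)) i)"
    for x :: "nat \<times> bool \<times> nat \<Rightarrow> int" and b j
  define \<sigma> where "\<sigma> k x = (\<Sum>j<J. Polynomial.monom 1 j *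
      (twisted_deriv f l k (R x True j) + [:e:] * twisted_deriv f (l + h) k (R x False j)))" for k x
  have R_diff: "R (\<lambda>i. x i - y i) b j = R x b j - R y b j" for x y b j
    by (simp add: R_def sum_subtractf flip: diff_monom)
  have R_deg: "degree (R x b j) \<le> D" for x b j
    unfolding R_def by (intro degree_sum_le) (auto intro: order.trans[OF degree_monom_le])
  have R_coeff: "poly.coeff (R x b j) i = x (j, b, i)" if "i \<le> D" for x b j i
    using that by (simp add: R_def coeff_sum)
  have \<sigma>_diff: "\<sigma> k (\<lambda>i. x i - y i) = \<sigma> k x - \<sigma> k y" for k x y
    by (simp add: \<sigma>_def R_diff twisted_deriv_diff algebra_simps sum_subtractf del: mult_pCons_left mult_pCons_right flip: sum.distrib)
  have \<sigma>_coeff: "poly.coeff (\<sigma> k x) i = 0" if "k < l" "N \<le> i" for k x i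
  proof -
    have "degree (twisted_deriv f l k (R x True j) + [:e:] * twisted_deriv f (l + h) k (R x False j)) \<le> D + l * degree f" for j
    proof -
      have "degree (twisted_deriv f c k (R x b j)) \<le> D + l * degree f" for c b
        using \<open>k < l\<close> by (intro order.trans[OF degree_twisted_deriv] add_mono R_deg mult_right_mono) auto
      then show ?thesis
        by (simp add: degree_add_le order.trans[OF degree_smult_le])
    qed
    then have "degree (Polynomial.monom 1 j * (twisted_deriv f l k (R x True j) + [:e:] * twisted_deriv f (l + h) k (R x False j))) < N" if "j < J" for j
      using that unfolding N_def
      by (intro le_less_trans[OF degree_mult_le]) (simp add: degree_monom_eq add.assoc add_less_le_mono)
    then show ?thesis
      using \<open>N \<le> i\<close> unfolding \<sigma>_def coeff_sum
      by (intro sum.neutral) (meson coeff_eq_0 lessThan_iff less_le_trans)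
  qed
  have fin: "finite I" "finite K"
    by (simp_all add: I_def K_def)
  have "card K < card I"
    using unknowns by (simp add: K_def I_def card_cartesian_product N_def mult_ac)
  then obtain x where x: "\<exists>i\<in>I. \<not> int p dvd x i"
    and xK: "\<And>k. k \<in> K \<Longrightarrow> int p dvd poly.coeff (\<sigma> (fst k) x) (snd k)"
    using nontrivial_kernel_mod[OF fin _ prime_gt_1_nat[OF p],
        where L = "\<lambda>k x. poly.coeff (\<sigma> (fst k) x) (snd k)"]
    unfolding \<sigma>_diff coeff_diff by metis
  have \<sigma>: "[:int p:] dvd \<sigma> k x" if "k < l" for k
    unfolding const_poly_dvd_iff
  proof
    fix i
    show "int p dvd poly.coeff (\<sigma> k x) i"
      using xK[of "(k, i)"] \<sigma>_coeff[OF that, of i x] that by (cases "i < N") (auto simp: K_def)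
  qed
  define X where "X j = Polynomial.monom (1::int) (j * p)" for j
  define Q where "Q = (\<Sum>j<J. X j * (R x True j + R x False j * f ^ h))"
  define P where "P = f ^ l * Q"
  have "\<not> [:int p:] dvd f"
    using f0 const_dvd_imp_dvd_poly by blast
  moreover have "\<not> [:int p:] dvd Q"
  proof
    assume "[:int p:] dvd Q"
    then have "[:int p:] dvd R x True j \<and> [:int p:] dvd R x False j" if "j < J" for j
      unfolding Q_def X_def
      by (intro const_dvd_coeffs_of_stepanov_poly[OF p h f a f0 R_deg R_deg D]) (use that in auto)
    then have "[:int p:] dvd R x b j" if "j < J" for b j
      using that by (cases b) auto
    then have "int p dvd x (j, b, i)" if "j < J" "i \<le> D" for j b i
      using that R_coeff[of i x b j] by (metis const_poly_dvd_iff)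
    then show False
      using x by (auto simp: I_def)
  qed
  ultimately have nP: "\<not> [:int p:] dvd P"
    unfolding P_def using pp by (auto simp: prime_elem_dvd_mult_iff dest: prime_elem_dvd_power)
  have degP: "degree P \<le> (J - 1) * p + D + (l + h) * degree f"
  proof -
    have "degree (X j * (R x True j + R x False j * f ^ h)) \<le> (J - 1) * p + (D + h * degree f)" if "j < J" for j
    proof (intro order.trans[OF degree_mult_le] add_mono)
      show "degree (X j) \<le> (J - 1) * p"
        unfolding X_def using that by (intro order.trans[OF degree_monom_le] mult_right_mono) auto
      have "degree (R x False j * f ^ h) \<le> D + h * degree f"
        by (intro order.trans[OF degree_mult_le] add_mono R_deg) (metis degree_power_le mult.commute)
      then show "degree (R x True j + R x False j * f ^ h) \<le> D + h * degree f"
        using R_deg[of x True j] by (intro degree_add_le) auto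
    qed
    then have "degree Q \<le> (J - 1) * p + (D + h * degree f)"
      unfolding Q_def by (intro degree_sum_le) auto
    moreover have "degree P \<le> l * degree f + degree Q"
      unfolding P_def by (intro order.trans[OF degree_mult_le] add_mono) (auto intro: order.trans[OF degree_power_le])
    ultimately show ?thesis by (simp add: algebra_simps)
  qed
  have van: "int p dvd poly ((pderiv ^^ k) P) y" if y: "y \<in> S" and k: "k < l" for y k
  proof -
    \<comment> \<open>The factor \<open>f ^ l\<close> of \<open>P\<close> keeps the exponents
      \<open>l\<close> and \<open>l + h\<close> at least \<open>k\<close>, so
      \<open>twisted_deriv\<close> describes both derivatives. They share the power
      \<open>f ^ (l - k)\<close>, and what remains at \<open>y\<close> is
      \<open>\<sigma> k\<close>.\<close>
    define A where "A j = f ^ l * R x True j" for j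
    define B where "B j = f ^ (l + h) * R x False j" for j
    have dX: "[:int p:] dvd pderiv (X j)" for j
      by (auto simp: X_def pderiv_monom const_poly_dvd_iff)
    have P: "P = (\<Sum>j<J. X j * A j + X j * B j)"
      unfolding P_def Q_def A_def B_def by (simp add: sum_distrib_left algebra_simps power_add)
    have "(pderiv ^^ k) P - (\<Sum>j<J. X j * (pderiv ^^ k) (A j) + X j * (pderiv ^^ k) (B j))
      = (\<Sum>j<J. ((pderiv ^^ k) (X j * A j) - X j * (pderiv ^^ k) (A j))
              + ((pderiv ^^ k) (X j * B j) - X j * (pderiv ^^ k) (B j)))"
      unfolding P funpow_pderiv_sum funpow_pderiv_add by (simp add: algebra_simps sum_subtractf sum.distrib)
    also have "[:int p:] dvd \<dots>"
      by (intro dvd_sum dvd_add const_dvd_funpow_pderiv_mult dX)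
    finally have "[poly ((pderiv ^^ k) P) y = poly (\<Sum>j<J. X j * (pderiv ^^ k) (A j) + X j * (pderiv ^^ k) (B j)) y] (mod int p)"
      unfolding cong_iff_dvd_diff poly_diff[symmetric] by (rule const_dvd_imp_dvd_poly)
    also have "poly (\<Sum>j<J. X j * (pderiv ^^ k) (A j) + X j * (pderiv ^^ k) (B j)) y
      = (\<Sum>j<J. (y ^ j) ^ p * (poly f y ^ (l - k) *
           (poly (twisted_deriv f l k (R x True j)) y
             + poly f y ^ h * poly (twisted_deriv f (l + h) k (R x False j)) y)))"
    proof -
      have "(pderiv ^^ k) (B j) = f ^ (l - k) * f ^ h * twisted_deriv f (l + h) k (R x False j)" for j
        using k by (simp add: B_def funpow_pderiv_power_mult flip: power_add)
      moreover have "(pderiv ^^ k) (A j) = f ^ (l - k) * twisted_deriv f l k (R x True j)" for j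
        using k by (simp add: A_def funpow_pderiv_power_mult)
      ultimately show ?thesis
        by (simp add: X_def poly_sum poly_monom algebra_simps flip: power_mult)
    qed
    also have "[\<dots> = (\<Sum>j<J. y ^ j * (poly f y ^ (l - k) *
           (poly (twisted_deriv f l k (R x True j)) y
             + e * poly (twisted_deriv f (l + h) k (R x False j)) y)))] (mod int p)"
    proof (intro cong_sum cong_mult cong_add cong_refl e y)
      show "[(y ^ j) ^ p = y ^ j] (mod int p)" for j
        using fermat_int[OF p] by (simp add: cong_iff_dvd_diff)
    qed
    also have "(\<Sum>j<J. y ^ j * (poly f y ^ (l - k) *
           (poly (twisted_deriv f l k (R x True j)) y
             + e * poly (twisted_deriv f (l + h) k (R x False j)) y)))
       = poly f y ^ (l - k) * poly (\<sigma> k x) y"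
      unfolding \<sigma>_def by (simp add: poly_sum poly_monom sum_distrib_left algebra_simps)
    also have "[\<dots> = 0] (mod int p)"
      using const_dvd_imp_dvd_poly[OF \<sigma>[OF k], of y] by (simp add: cong_0_iff)
    finally show ?thesis
      by (simp add: cong_0_iff)
  qed
  have "(\<Sum>y\<in>S. l) \<le> degree P"
    by (rule sum_multiplicity_le_degree_mod[OF _ \<open>finite S\<close> S nP]) (use p l van in auto)
  then show ?thesis
    using degP by (simp add: mult.commute)
qed

subsection \<open>Character sums and sign patterns\<close>

lemma eventually_at_top_odd_primes:
  "eventually P at_top_odd_primes \<longleftrightarrow> (\<exists>N. \<forall>p\<ge>N. prime p \<and> odd p \<longrightarrow> P p)"
  by (simp add: at_top_odd_primes_def eventually_inf_principal eventually_at_top_linorder)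

text \<open>\<open>stepanov_bound\<close> with multiplicity \<open>2 * t\<close> and \<open>J = t + 1\<close>. The bound is
  \<open>p / 2 + O(p / t)\<close> for fixed \<open>card T\<close>.\<close>

lemma card_prod_Legendre_eq_le:
  fixes T :: "nat set"
  assumes p: "prime p" "odd p" and T: "T \<subseteq> {1..<p}" "T \<noteq> {}"
    and t: "t > 0" and large: "card T + 1 + 2 * (t * (t + 2 * t * card T)) \<le> p"
  shows "2 * t * card {x \<in> {..<p}. (\<Prod>w\<in>T. Legendre (int (x + w)) (int p)) = e}
    \<le> t * p + (card T + 1) * p + 2 * t * card T"
proof -
  have "finite T" using T(1) by (rule finite_subset) simp
  define m where "m = card T"
  define h where "h = (p - 1) div 2"
  have "p > 2" using p prime_ge_2_nat[of p] by (cases "p = 2") auto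
  then have h: "2 * h + 1 = p" using p(2) by (simp add: h_def)
  obtain w0 where w0: "w0 \<in> T" using T(2) by blast
  define f where "f = (\<Prod>w\<in>T. [:int w, 1:])"
  \<comment> \<open>The elements of \<open>T\<close> are distinct and nonzero modulo
    \<open>p\<close>. Hence the zero \<open>- w0\<close> of \<open>f\<close> is simple modulo
    \<open>p\<close>, and \<open>f(0)\<close> is nonzero.\<close>
  define f2 where "f2 = (\<Prod>w\<in>T - {w0}. [:int w, 1:])"
  have f: "f = [:- (- int w0), 1:] * f2"
    unfolding f_def f2_def using w0 \<open>finite T\<close> by (simp add: prod.remove del: mult_pCons_left)
  have prime_int: "prime (int p)" using p by simp
  have f2: "\<not> int p dvd poly f2 (- int w0)"
  proof -
    have "\<not> int p dvd int w - int w0" if "w \<in> T - {w0}" for w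
      using that subsetD[OF T(1) w0] subsetD[OF T(1), of w]
      by (intro not_dvd_int_between) (auto simp: abs_less_iff)
    then show ?thesis
      using \<open>finite T\<close> by (auto simp: f2_def poly_prod prime_dvd_prod_iff[OF _ prime_int])
  qed
  have f0: "\<not> int p dvd poly f 0"
  proof -
    have "\<not> int p dvd int w" if "w \<in> T" for w
      using that T by (intro not_dvd_int_between) auto
    then show ?thesis
      using \<open>finite T\<close> by (auto simp: f_def poly_prod prime_dvd_prod_iff[OF _ prime_int])
  qed
  have deg: "degree f = m"
    unfolding f_def m_def by (subst degree_prod_eq_sum_degree) auto
  define A where "A = {x \<in> {..<p}. (\<Prod>w\<in>T. Legendre (int (x + w)) (int p)) = e}"
  \<comment> \<open>This is the largest \<open>D\<close> with \<open>2 * D + m < p\<close>. The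
    unknowns then outnumber the equations by \<open>2 * (D + 1) - 2 * t * (t + 2 * t * m)\<close>,
    which \<open>large\<close> makes positive.\<close>
  define D where "D = (p - 1 - m) div 2"
  have D: "2 * D + m < p" "t * (t + 2 * t * m) \<le> D"
    using large unfolding D_def m_def by auto
  have "2 * t * card (int ` A) \<le> (t + 1 - 1) * p + D + (2 * t + h) * m"
    unfolding deg[symmetric]
  proof (rule stepanov_bound[OF p(1) h f f2 f0])
    show "int ` A \<subseteq> {0..<int p}" by (auto simp: A_def)
    show "[poly f x ^ h = e] (mod int p)" if x: "x \<in> int ` A" for x
    proof -
      obtain y where y: "x = int y" "y \<in> A" using x by blast
      have "poly f x ^ h = (\<Prod>w\<in>T. int (y + w) ^ h)"
        by (simp add: f_def poly_prod prod_power_distrib y add.commute)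
      also have "[\<dots> = (\<Prod>w\<in>T. Legendre (int (y + w)) (int p))] (mod int p)"
        unfolding h_def by (intro cong_prod cong_sym[OF euler_criterion]) (use p \<open>p > 2\<close> in auto)
      also have "(\<Prod>w\<in>T. Legendre (int (y + w)) (int p)) = e" using y by (simp add: A_def)
      finally show ?thesis .
    qed
    show "2 * D + degree f < p" using D deg by simp
    show "2 * t \<le> p"
    proof -
      have "t * 1 \<le> t * (t + 2 * t * card T)" using t by (intro mult_left_mono) auto
      then show ?thesis using large by linarith
    qed
    have "2 * (t * (t + 2 * t * m)) < 2 * (D + 1)" using D by simp
    then show "2 * t * (t + 1 + D + 2 * t * degree f) < 2 * (t + 1) * (D + 1)"
      by (simp add: deg algebra_simps)
  qed
  also have "card (int ` A) = card A"
    by (simp add: card_image)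
  also have "(t + 1 - 1) * p + D + (2 * t + h) * m \<le> t * p + p + (2 * t + p) * m"
    using h D by (intro add_mono mult_right_mono) auto
  also have "\<dots> = t * p + (m + 1) * p + 2 * t * m"
    by (simp add: algebra_simps)
  finally show ?thesis
    unfolding A_def m_def .
qed

lemma prod_Legendre_cases:
  "(\<Prod>w\<in>T. Legendre (int (x + w)) p) \<in> {-1, 0, 1}"
proof (induction T rule: infinite_finite_induct)
  case (insert w T)
  have "Legendre (int (x + w)) p \<in> {-1, 0, 1}" by (auto simp: Legendre_def)
  with insert show ?case by (auto simp del: of_nat_add)
qed simp_all

text \<open>Each of the values \<open>1\<close> and \<open>-1\<close> is taken at most slightly more
  than \<open>p / 2\<close> times, and the value \<open>0\<close> at most \<open>card T\<close>
  times. As the three counts add up to \<open>p\<close>, the first two nearly agree, and the sum is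
  their difference.\<close>

lemma sum_prod_Legendre_small:
  fixes T :: "nat set"
  assumes "finite T" "T \<noteq> {}" "0 \<notin> T" "\<delta> > 0"
  shows "\<forall>\<^sub>F p in at_top_odd_primes.
    \<bar>\<Sum>x<p. \<Prod>w\<in>T. Legendre (int (x + w)) (int p)\<bar> \<le> \<delta> * real p"
proof -
  define m where "m = card T"
  \<comment> \<open>\<open>t\<close> makes the error \<open>(m + 1) / t * p\<close> at most
    \<open>\<delta> / 2 * p\<close>; \<open>N\<close> below does the same for
    \<open>3 * m\<close>.\<close>
  obtain t :: nat where t0: "2 * (m + 1) / \<delta> < real t"
    using reals_Archimedean2 by blast
  moreover have "2 * (m + 1) / \<delta> > 0" using \<open>\<delta> > 0\<close> by simp
  ultimately have t: "t > 0" by (metis of_nat_0 of_nat_less_iff order_less_trans)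
  obtain N :: nat where N: "6 * m / \<delta> < real N"
    using reals_Archimedean2 by blast
  define p0 where "p0 = Max T + 1 + (m + 1 + 2 * (t * (t + 2 * t * m))) + N"
  have "\<bar>\<Sum>x<p. \<Prod>w\<in>T. Legendre (int (x + w)) (int p)\<bar> \<le> \<delta> * real p"
    if "p \<ge> p0" "prime p" "odd p" for p
  proof -
    define g where "g x = (\<Prod>w\<in>T. Legendre (int (x + w)) (int p))" for x
    define A where "A e = {x \<in> {..<p}. g x = e}" for e
    have fin: "finite (A e)" for e by (simp add: A_def)
    have T: "T \<subseteq> {1..<p}"
    proof
      fix w assume "w \<in> T"
      then have "w \<le> Max T" "w \<noteq> 0" using assms by (auto intro: Max_ge)
      then show "w \<in> {1..<p}" using that(1) by (auto simp: p0_def)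
    qed
    have "2 * t * card (A e) \<le> t * p + (m + 1) * p + 2 * t * m" for e
      unfolding A_def g_def m_def
      by (rule card_prod_Legendre_eq_le[OF that(2,3) T assms(2) t])
        (use that(1) in \<open>simp add: p0_def m_def\<close>)
    then have "real (2 * t * card (A e)) \<le> real (t * p + (m + 1) * p + 2 * t * m)" for e
      using of_nat_mono by blast
    then have bound: "2 * card (A e) \<le> p + (m + 1) / t * p + 2 * m" for e
      using t by (simp add: field_simps)
    \<comment> \<open>A zero factor means that \<open>p\<close> divides \<open>x + w\<close>; as
      this lies strictly between \<open>0\<close> and \<open>2 * p\<close>, it equals
      \<open>p\<close>.\<close>
    have "A 0 \<subseteq> (\<lambda>w. p - w) ` T"
    proof
      fix x assume "x \<in> A 0"
      then obtain w where w: "x < p" "w \<in> T" "Legendre (int (x + w)) (int p) = 0"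
        using \<open>finite T\<close> by (auto simp: A_def g_def)
      then have "int p dvd int (x + w)"
        by (auto simp: Legendre_def cong_0_iff split: if_splits)
      then obtain c where c: "x + w = p * c" by (metis dvdE int_dvd_int_iff)
      moreover have "0 < x + w" "x + w < p * 2" using w T by auto
      ultimately have "c = 1" by (cases c) auto
      then show "x \<in> (\<lambda>w. p - w) ` T"
        using c w by (auto intro!: image_eqI[of _ _ w])
    qed
    then have A0: "card (A 0) \<le> m"
      unfolding m_def using \<open>finite T\<close> by (metis card_image_le card_mono finite_imageI order.trans)
    have split: "{..<p} = A 1 \<union> A (-1) \<union> A 0"
      using prod_Legendre_cases[where T = T] by (auto simp: A_def g_def)
    have disj: "A 1 \<inter> A (-1) = {}" "(A 1 \<union> A (-1)) \<inter> A 0 = {}"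
      by (auto simp: A_def)
    have "card {..<p} = card (A 1) + card (A (-1)) + card (A 0)"
      unfolding split using fin disj by (simp add: card_Un_disjoint)
    then have c: "card (A 1) + card (A (-1)) + card (A 0) = p" by simp
    have "(\<Sum>x<p. g x) = (\<Sum>x\<in>A 1. g x) + (\<Sum>x\<in>A (-1). g x) + (\<Sum>x\<in>A 0. g x)"
      unfolding split using fin disj by (simp add: sum.union_disjoint)
    moreover have "(\<Sum>x\<in>A e. g x) = e * int (card (A e))" for e
      by (simp add: A_def mult.commute)
    ultimately have s: "(\<Sum>x<p. g x) = int (card (A 1)) - int (card (A (-1)))"
      by (metis add_0_right mult_minus_left mult_1 mult_zero_left diff_conv_add_uminus)
    \<comment> \<open>With total \<open>p\<close>, the difference of the two counts is
      \<open>2 * card (A 1) - p + card (A 0)\<close>, and symmetrically with \<open>-1\<close>; the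
      last term turns \<open>2 * m\<close> into \<open>3 * m\<close>.\<close>
    have "\<bar>real (card (A 1)) - real (card (A (-1)))\<bar> \<le> (m + 1) / t * p + 3 * m"
      using bound[of 1] bound[of "-1"] A0 c by linarith
    moreover have "(m + 1) / t \<le> \<delta> / 2"
      using t0 t \<open>\<delta> > 0\<close> by (simp add: field_simps)
    then have "(m + 1) / t * p \<le> \<delta> / 2 * p"
      by (rule mult_right_mono) simp
    moreover have "6 * m / \<delta> < p"
      using N that(1) by (simp add: p0_def)
    then have "3 * m \<le> \<delta> / 2 * p"
      using \<open>\<delta> > 0\<close> by (simp add: field_simps)
    ultimately have "\<bar>real (card (A 1)) - real (card (A (-1)))\<bar> \<le> \<delta> * p"
      by linarith
    then show ?thesis
      using s by (simp add: g_def)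
  qed
  then show ?thesis
    unfolding eventually_at_top_odd_primes by blast
qed

section \<open>From character sums to counts of sign patterns\<close>

lemma prod_one_plus_signs:
  fixes u :: "'a \<Rightarrow> int"
  assumes "finite W" "\<And>w. w \<in> W \<Longrightarrow> u w \<in> {-1, 1}" "\<And>w. w \<in> W \<Longrightarrow> v w \<in> {-1, 1}"
  shows "(\<Prod>w\<in>W. 1 + u w * v w) = (if \<forall>w\<in>W. u w = v w then 2 ^ card W else 0)"
  using assms
proof (induction W rule: finite_induct)
  case (insert w W)
  have "(\<Prod>w\<in>W. 1 + u w * v w) = (if \<forall>w\<in>W. u w = v w then 2 ^ card W else 0)"
    using insert by (intro insert.IH) auto
  moreover have "u w = -1 \<or> u w = 1" "v w = -1 \<or> v w = 1"
    using insert.prems(1)[of w] insert.prems(2)[of w] by auto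
  ultimately show ?case
    using insert.hyps by auto
qed simp

text \<open>One threshold serves all \<open>\<epsilon>\<close>, because the signs enter the
  expansion only as coefficients of absolute value \<open>1\<close> of finitely many character sums.
  For \<open>n < p - M\<close> all \<open>n + w\<close> stay below \<open>p\<close>, so no Legendre
  symbol is \<open>0\<close>.\<close>

lemma card_pattern_estimate:
  assumes W: "W \<subseteq> {..M}" and "\<delta> > 0"
  shows "\<forall>\<^sub>F p in at_top_odd_primes. \<forall>\<epsilon> \<in> W \<rightarrow> {-1, 1}.
    \<bar>2 ^ card W * real (card {n \<in> {1..<p - M}. \<forall>w\<in>W. Legendre (int (n + w)) (int p) = \<epsilon> w}) - real p\<bar>
      \<le> \<delta> * real p"
proof -
  have "finite W" using W by (rule finite_subset) simp
  define c :: real where "c = 2 ^ card W"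
  have "c > 0" by (simp add: c_def)
  \<comment> \<open>Fewer than \<open>c\<close> nonempty subsets occur, each with error
    \<open>\<delta>' * p + (M + 1)\<close>. The first parts total at most
    \<open>\<delta> / 2 * p\<close>; the boundary terms and the \<open>M + 1\<close> omitted shifts
    total at most \<open>(M + 1) * (1 + c)\<close>, which the other half absorbs for large
    \<open>p\<close>.\<close>
  define \<delta>' where "\<delta>' = \<delta> / (2 * c)"
  have "\<delta>' > 0" using \<open>\<delta> > 0\<close> \<open>c > 0\<close> by (simp add: \<delta>'_def)
  have "\<forall>\<^sub>F p in at_top_odd_primes. \<forall>T\<in>Pow W - {{}}.
    \<bar>\<Sum>x<p. \<Prod>w\<in>Suc ` T. Legendre (int (x + w)) (int p)\<bar> \<le> \<delta>' * real p"
  proof (rule eventually_ball_finite)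
    show "\<forall>T\<in>Pow W - {{}}. \<forall>\<^sub>F p in at_top_odd_primes.
        \<bar>\<Sum>x<p. \<Prod>w\<in>Suc ` T. Legendre (int (x + w)) (int p)\<bar> \<le> \<delta>' * real p"
      using \<open>finite W\<close> \<open>\<delta>' > 0\<close>
      by (intro ballI sum_prod_Legendre_small) (auto intro: finite_subset)
  qed (use \<open>finite W\<close> in simp)
  moreover have "\<forall>\<^sub>F p in at_top_odd_primes. prime p \<and> odd p"
    by (simp add: eventually_at_top_odd_primes)
  moreover have "\<forall>\<^sub>F p in at_top_odd_primes. M + 1 + nat \<lceil>(M + 1) * (1 + c) * 2 / \<delta>\<rceil> \<le> p"
    by (auto simp: eventually_at_top_odd_primes)
  ultimately show ?thesis
  proof eventually_elim
    case (elim p)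
    define X where "X n w = Legendre (int (n + w)) (int p)" for n w
    have small: "\<bar>\<Sum>n\<in>{1..<p - M}. \<Prod>w\<in>T. X n w\<bar> \<le> \<delta>' * real p + (M + 1)"
      if "T \<in> Pow W - {{}}" for T
    proof -
      \<comment> \<open>Substituting \<open>n = x + 1\<close> moves the offsets to
        \<open>w + 1\<close>, which excludes the offset \<open>0\<close> as
        \<open>sum_prod_Legendre_small\<close> requires. The complete sum over \<open>x < p\<close>
        has \<open>M + 1\<close> further terms, each of absolute value at most
        \<open>1\<close>.\<close>
      define g where "g x = (\<Prod>w\<in>T. X (Suc x) w)" for x
      have g: "g x = (\<Prod>w\<in>Suc ` T. Legendre (int (x + w)) (int p))" for x
        by (simp add: g_def X_def prod.reindex ac_simps)
      have "(\<Sum>n\<in>{1..<p - M}. \<Prod>w\<in>T. X n w) = (\<Sum>x<p - M - 1. g x)"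
        by (rule sum.reindex_bij_witness[of _ Suc "\<lambda>n. n - 1"]) (auto simp: g_def)
      moreover have "(\<Sum>x<p. g x) = (\<Sum>x<p - M - 1. g x) + (\<Sum>x\<in>{p - M - 1..<p}. g x)"
      proof -
        have "{..<p} = {..<p - M - 1} \<union> {p - M - 1..<p}" by auto
        then show ?thesis by (simp add: sum.union_disjoint ivl_disj_int)
      qed
      ultimately have "real_of_int (\<Sum>n\<in>{1..<p - M}. \<Prod>w\<in>T. X n w)
          = real_of_int (\<Sum>x<p. g x) - real_of_int (\<Sum>x\<in>{p - M - 1..<p}. g x)"
        by simp
      moreover have "\<bar>\<Sum>x\<in>{p - M - 1..<p}. g x\<bar> \<le> int (M + 1)"
      proof -
        have "\<bar>g x\<bar> \<le> 1" for x
          using prod_Legendre_cases[of x "int p" "Suc ` T"] unfolding g by auto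
        then have "\<bar>\<Sum>x\<in>{p - M - 1..<p}. g x\<bar> \<le> (\<Sum>x\<in>{p - M - 1..<p}. 1)"
          by (intro order.trans[OF sum_abs] sum_mono)
        then show ?thesis by simp
      qed
      then have "\<bar>real_of_int (\<Sum>x\<in>{p - M - 1..<p}. g x)\<bar> \<le> M + 1"
        by linarith
      moreover have "\<bar>\<Sum>x<p. g x\<bar> \<le> \<delta>' * real p"
        using elim(1) that unfolding g by blast
      ultimately show ?thesis by linarith
    qed
    show ?case
    proof
      fix \<epsilon> :: "nat \<Rightarrow> int" assume \<epsilon>: "\<epsilon> \<in> W \<rightarrow> {-1, 1}"
      define C where "C = {n \<in> {1..<p - M}. \<forall>w\<in>W. X n w = \<epsilon> w}"
      have X: "X n w \<in> {-1, 1}" if "n \<in> {1..<p - M}" "w \<in> W" for n w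
      proof -
        have "\<not> int p dvd int (n + w)"
          using that W by (intro not_dvd_int_between) auto
        then show ?thesis by (auto simp: X_def Legendre_def cong_0_iff)
      qed
      have "2 ^ card W * int (card C) = (\<Sum>n\<in>{1..<p - M}. if \<forall>w\<in>W. X n w = \<epsilon> w then 2 ^ card W else 0)"
        by (simp add: C_def sum.If_cases Int_def)
      also have "\<dots> = (\<Sum>n\<in>{1..<p - M}. \<Prod>w\<in>W. X n w * \<epsilon> w + 1)"
      proof (rule sum.cong[OF refl])
        fix n assume n: "n \<in> {1..<p - M}"
        have "(\<Prod>w\<in>W. 1 + X n w * \<epsilon> w) = (if \<forall>w\<in>W. X n w = \<epsilon> w then 2 ^ card W else 0)"
          using \<open>finite W\<close> X[OF n] funcset_mem[OF \<epsilon>] by (rule prod_one_plus_signs)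
        then show "(if \<forall>w\<in>W. X n w = \<epsilon> w then 2 ^ card W else 0) = (\<Prod>w\<in>W. X n w * \<epsilon> w + 1)"
          by (simp add: add.commute)
      qed
      also have "\<dots> = (\<Sum>T\<in>Pow W. (\<Prod>w\<in>T. \<epsilon> w) * (\<Sum>n\<in>{1..<p - M}. \<Prod>w\<in>T. X n w))"
        unfolding prod_add[OF \<open>finite W\<close>]
        by (subst sum.swap) (simp add: prod.distrib sum_distrib_left mult.commute)
      also have "\<dots> = int (p - M - 1) + (\<Sum>T\<in>Pow W - {{}}. (\<Prod>w\<in>T. \<epsilon> w) * (\<Sum>n\<in>{1..<p - M}. \<Prod>w\<in>T. X n w))"
        using \<open>finite W\<close> by (subst sum.remove[of _ "{}"]) auto
      finally have main: "2 ^ card W * int (card C) - int (p - M - 1) = \<dots> - int (p - M - 1)" by simp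
      have "\<bar>(\<Prod>w\<in>T. \<epsilon> w) * (\<Sum>n\<in>{1..<p - M}. \<Prod>w\<in>T. X n w)\<bar> \<le> \<delta>' * real p + (M + 1)"
        if "T \<in> Pow W - {{}}" for T
      proof -
        have "\<bar>\<Prod>w\<in>T. \<epsilon> w\<bar> = 1"
          unfolding abs_prod using that \<epsilon> by (intro prod.neutral) (auto dest!: funcset_mem[OF \<epsilon>] subsetD)
        then show ?thesis
          using small[OF that] by (simp add: abs_mult)
      qed
      then have "\<bar>real_of_int (\<Sum>T\<in>Pow W - {{}}. (\<Prod>w\<in>T. \<epsilon> w) * (\<Sum>n\<in>{1..<p - M}. \<Prod>w\<in>T. X n w))\<bar>
          \<le> (\<Sum>T\<in>Pow W - {{}}. \<delta>' * real p + (M + 1))"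
        unfolding of_int_sum by (intro order.trans[OF sum_abs] sum_mono) simp
      also have "\<dots> = real (card (Pow W - {{}})) * (\<delta>' * real p + (M + 1))"
        by simp
      also have "\<dots> \<le> c * (\<delta>' * real p + (M + 1))"
      proof (rule mult_right_mono)
        have "card (Pow W - {{}}) \<le> 2 ^ card W"
          using \<open>finite W\<close> by (metis card_Diff1_le card_Pow)
        then show "real (card (Pow W - {{}})) \<le> c"
          unfolding c_def by (metis of_nat_mono of_nat_numeral of_nat_power)
      qed (use \<open>\<delta>' > 0\<close> in simp)
      finally have "\<bar>real_of_int (2 ^ card W * int (card C) - int (p - M - 1))\<bar> \<le> c * (\<delta>' * real p + (M + 1))"
        unfolding main by simp
      then have "\<bar>c * real (card C) - (real p - M - 1)\<bar> \<le> c * (\<delta>' * real p + (M + 1))"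
        using elim(3) by (simp add: c_def of_nat_diff)
      moreover have "c * (\<delta>' * real p + (M + 1)) = \<delta> / 2 * p + c * (M + 1)"
        using \<open>c > 0\<close> by (simp add: \<delta>'_def field_simps)
      moreover have "(M + 1) * (1 + c) * 2 / \<delta> \<le> p"
        using elim(3) by linarith
      then have "(M + 1) * (1 + c) \<le> \<delta> / 2 * p"
        using \<open>\<delta> > 0\<close> by (simp add: field_simps)
      then have "c * (M + 1) + (M + 1) \<le> \<delta> / 2 * p" by (simp add: algebra_simps)
      ultimately have "\<bar>c * real (card C) - real p\<bar> \<le> \<delta> * p" by linarith
      then show "\<bar>2 ^ card W * real (card {n \<in> {1..<p - M}. \<forall>w\<in>W. Legendre (int (n + w)) (int p) = \<epsilon> w}) - real p\<bar> \<le> \<delta> * real p"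
        by (simp add: c_def C_def X_def)
    qed
  qed
qed

lemma card_pattern_asymp:
  assumes "W \<subseteq> {..M}" "\<epsilon> \<in> W \<rightarrow> {-1, 1}"
  shows "(\<lambda>p. real (card {n \<in> {1..<p - M}. \<forall>w\<in>W. Legendre (int (n + w)) (int p) = \<epsilon> w}))
    \<sim>[at_top_odd_primes] (\<lambda>p. real p / 2 ^ card W)"
proof (rule asymp_equivI', rule tendstoI)
  fix e :: real assume "e > 0"
  have pos: "\<forall>\<^sub>F p in at_top_odd_primes. p > 0"
    by (simp add: eventually_at_top_odd_primes prime_gt_0_nat)
  show "\<forall>\<^sub>F p in at_top_odd_primes.
    dist (real (card {n \<in> {1..<p - M}. \<forall>w\<in>W. Legendre (int (n + w)) (int p) = \<epsilon> w}) / (real p / 2 ^ card W)) 1 < e"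
    using card_pattern_estimate[OF assms(1) half_gt_zero[OF \<open>e > 0\<close>]] pos
  proof eventually_elim
    case (elim p)
    define C where "C = real (card {n \<in> {1..<p - M}. \<forall>w\<in>W. Legendre (int (n + w)) (int p) = \<epsilon> w})"
    have "\<bar>2 ^ card W * C - real p\<bar> \<le> e / 2 * real p"
      using elim(1) assms(2) unfolding C_def by blast
    also have "\<dots> < e * real p" using \<open>e > 0\<close> elim(2) by simp
    finally have "\<bar>2 ^ card W * C - real p\<bar> / real p < e"
      using elim(2) by (simp add: divide_less_eq)
    moreover have "\<bar>2 ^ card W * C - real p\<bar> / real p = \<bar>C / (real p / 2 ^ card W) - 1\<bar>"
    proof -
      have "(2 ^ card W * C - real p) / real p = C / (real p / 2 ^ card W) - 1"
        using elim(2) by (simp add: field_simps)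
      then show ?thesis by (metis abs_divide abs_of_nat)
    qed
    ultimately show ?case
      unfolding C_def dist_real_def by simp
  qed
qed

text \<open>A relative error of \<open>1 / 2\<close> already makes the count positive, for all sign
  choices at once.\<close>

lemma eventually_pattern_exists:
  assumes "W \<subseteq> {..M}"
  shows "\<forall>\<^sub>F p in at_top_odd_primes. \<forall>\<epsilon> \<in> W \<rightarrow> {-1, 1}.
    \<exists>n\<in>{1..<p - M}. \<forall>w\<in>W. Legendre (int (n + w)) (int p) = \<epsilon> w"
proof -
  have "\<forall>\<^sub>F p in at_top_odd_primes. p > 0"
    by (simp add: eventually_at_top_odd_primes prime_gt_0_nat)
  with card_pattern_estimate[OF assms half_gt_zero[OF zero_less_one]] show ?thesis
  proof eventually_elim
    case (elim p)
    show ?case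
    proof
      fix \<epsilon> :: "nat \<Rightarrow> int" assume \<epsilon>: "\<epsilon> \<in> W \<rightarrow> {-1, 1}"
      define A where "A = {n \<in> {1..<p - M}. \<forall>w\<in>W. Legendre (int (n + w)) (int p) = \<epsilon> w}"
      have "\<bar>2 ^ card W * real (card A) - real p\<bar> \<le> 1 / 2 * real p"
        using elim(1) \<epsilon> unfolding A_def by blast
      then have "A \<noteq> {}"
        using elim(2) by auto
      then show "\<exists>n\<in>{1..<p - M}. \<forall>w\<in>W. Legendre (int (n + w)) (int p) = \<epsilon> w"
        unfolding A_def by blast
    qed
  qed
qed

subsection \<open>Translates and support sets\<close>

lemma inj_translate: "inj (\<lambda>n. (+) n ` Z)" if "0 \<in> Z" for Z :: "nat set"
proof (rule injI)
  fix m n assume eq: "(+) m ` Z = (+) n ` Z"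
  have "l \<in> (+) l ` Z" for l
    using that by (intro image_eqI[of _ _ 0]) auto
  then have "m \<in> (+) n ` Z" "n \<in> (+) m ` Z"
    using eq by blast+
  then show "m = n" by auto
qed

lemma translate_subset_iff:
  assumes "finite Z" "0 \<in> Z" "n \<ge> (1 :: nat)"
  shows "(+) n ` Z \<subseteq> {1..p - 1} \<longleftrightarrow> n \<in> {1..<p - Max Z}"
proof
  assume "(+) n ` Z \<subseteq> {1..p - 1}"
  moreover have "n + Max Z \<in> (+) n ` Z" using assms by (intro imageI Max_in) auto
  ultimately have "n + Max Z \<le> p - 1" by (metis subsetD atLeastAtMost_iff)
  then show "n \<in> {1..<p - Max Z}" using assms by auto
next
  assume "n \<in> {1..<p - Max Z}"
  moreover have "z \<le> Max Z" if "z \<in> Z" for z using assms that by simp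
  ultimately have "n + z \<in> {1..p - 1}" if "z \<in> Z" for z using that by force
  then show "(+) n ` Z \<subseteq> {1..p - 1}" by blast
qed

text \<open>Because \<open>0 \<in> Z\<close>, the shift is recovered as the least element of the
  translate, so counting sets amounts to counting shifts.\<close>

lemma card_translates:
  assumes "finite Z" "0 \<in> Z" "\<And>n. n \<in> {1..<p - Max Z} \<Longrightarrow> Q ((+) n ` Z) \<longleftrightarrow> R n"
  shows "card {S \<in> translates Z \<inter> Pow {1..p - 1}. Q S} = card {n \<in> {1..<p - Max Z}. R n}"
proof -
  have "{S \<in> translates Z \<inter> Pow {1..p - 1}. Q S}
      = (\<lambda>n. (+) n ` Z) ` {n. n \<ge> 1 \<and> (+) n ` Z \<subseteq> {1..p - 1} \<and> Q ((+) n ` Z)}"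
    unfolding translates_def by blast
  also have "{n. n \<ge> 1 \<and> (+) n ` Z \<subseteq> {1..p - 1} \<and> Q ((+) n ` Z)} = {n \<in> {1..<p - Max Z}. R n}"
  proof (rule Collect_cong)
    fix n
    show "n \<ge> 1 \<and> (+) n ` Z \<subseteq> {1..p - 1} \<and> Q ((+) n ` Z) \<longleftrightarrow> n \<in> {1..<p - Max Z} \<and> R n"
    proof (cases "n \<ge> 1")
      case True
      then show ?thesis
        using translate_subset_iff[OF assms(1,2) True, of p] assms(3)[of n] by blast
    qed simp
  qed
  finally have "{S \<in> translates Z \<inter> Pow {1..p - 1}. Q S} = (\<lambda>n. (+) n ` Z) ` {n \<in> {1..<p - Max Z}. R n}" .
  then show ?thesis
    using inj_translate[OF assms(2)] by (simp add: card_image inj_on_subset)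
qed

section \<open>Patterns and support sets as conditions on the shift\<close>

lemma bij_betw_nth_elem: "finite Z \<Longrightarrow> bij_betw (nth_elem Z) {1..card Z} Z"
proof -
  assume "finite Z"
  then have "bij_betw ((!) (sorted_list_of_set Z)) {..<card Z} Z"
    by (intro bij_betw_nth) auto
  moreover have "bij_betw (\<lambda>i. i - 1) {1..card Z} {..<card Z}"
    by (rule bij_betw_byWitness[of _ Suc]) auto
  ultimately have "bij_betw ((!) (sorted_list_of_set Z) \<circ> (\<lambda>i. i - 1)) {1..card Z} Z"
    by (rule bij_betw_trans[rotated])
  then show ?thesis
    by (simp add: nth_elem_def[abs_def] comp_def)
qed

text \<open>Signs are attached to indices in a pattern but to offsets in the counting estimates; the
  inverse of the increasing enumeration of \<open>Z\<close> carries one to the other.\<close>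

lemma residue_pattern_translate_iff:
  assumes "finite Z" "0 \<in> Z" "n \<ge> 1"
  shows "residue_pattern Z ((+) n ` Z) \<epsilon> p \<longleftrightarrow>
    (\<forall>z\<in>Z. Legendre (int (n + z)) (int p) = \<epsilon> (inv_into {1..card Z} (nth_elem Z) z))"
proof -
  have bij: "bij_betw (nth_elem Z) {1..card Z} Z"
    using assms(1) by (rule bij_betw_nth_elem)
  have inj: "(+) n ` Z = (+) m ` Z \<longleftrightarrow> n = m" for m
    using injD[OF inj_translate[OF assms(2)]] by blast
  have "residue_pattern Z ((+) n ` Z) \<epsilon> p \<longleftrightarrow>
      (\<forall>i\<in>{1..card Z}. Legendre (int (n + nth_elem Z i)) (int p) = \<epsilon> i)"
    unfolding residue_pattern_def inj using assms(3) by blast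
  also have "\<dots> \<longleftrightarrow> (\<forall>i\<in>{1..card Z}. Legendre (int (n + nth_elem Z i)) (int p)
      = \<epsilon> (inv_into {1..card Z} (nth_elem Z) (nth_elem Z i)))"
    by (rule ball_cong[OF refl]) (simp only: inv_into_f_f[OF bij_betw_imp_inj_on[OF bij]])
  also have "\<dots> \<longleftrightarrow> (\<forall>z\<in>nth_elem Z ` {1..card Z}.
      Legendre (int (n + z)) (int p) = \<epsilon> (inv_into {1..card Z} (nth_elem Z) z))"
    by blast
  finally show ?thesis
    unfolding bij_betw_imp_surj_on[OF bij] .
qed

lemma sign_choices_inv_nth_elem:
  assumes "finite Z" "\<epsilon> \<in> sign_choices (card Z)"
  shows "(\<lambda>z. \<epsilon> (inv_into {1..card Z} (nth_elem Z) z)) \<in> Z \<rightarrow> {-1, 1}"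
proof (rule Pi_I)
  fix z assume "z \<in> Z"
  then have "inv_into {1..card Z} (nth_elem Z) z \<in> {1..card Z}"
    using bij_betw_imp_surj_on[OF bij_betw_nth_elem[OF assms(1)]] by (intro inv_into_into) simp
  then show "\<epsilon> (inv_into {1..card Z} (nth_elem Z) z) \<in> {-1, 1}"
    using assms(2) unfolding sign_choices_def by (rule funcset_mem[rotated])
qed

text \<open>The span of \<open>n + Z\<close> runs from \<open>n\<close> to \<open>n + Max Z\<close>,
  so the offsets in the gaps of \<open>Z\<close> are constrained as well. All
  \<open>1 + Max Z\<close> offsets therefore count in the exponent for support sets.\<close>

lemma translate_eq_Int_iff:
  fixes n :: nat
  assumes "finite Z" "0 \<in> Z"
  shows "(+) n ` Z = Q \<inter> {Min ((+) n ` Z)..Max ((+) n ` Z)}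
    \<longleftrightarrow> (\<forall>w\<in>{..Max Z}. n + w \<in> Q \<longleftrightarrow> w \<in> Z)"
proof -
  have "Min ((+) n ` Z) = n"
    using assms by (intro Min_eqI) (auto intro!: image_eqI[of _ _ 0])
  moreover have "Max ((+) n ` Z) = n + Max Z"
    using assms by (intro Max_eqI imageI Max_in) auto
  moreover have "(+) n ` Z = Q \<inter> {n..n + Max Z} \<longleftrightarrow> (\<forall>w\<in>{..Max Z}. n + w \<in> Q \<longleftrightarrow> w \<in> Z)"
  proof
    assume *: "(+) n ` Z = Q \<inter> {n..n + Max Z}"
    show "\<forall>w\<in>{..Max Z}. n + w \<in> Q \<longleftrightarrow> w \<in> Z"
    proof
      fix w assume "w \<in> {..Max Z}"
      then have "n + w \<in> Q \<longleftrightarrow> n + w \<in> (+) n ` Z" unfolding * by simp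
      then show "n + w \<in> Q \<longleftrightarrow> w \<in> Z" by auto
    qed
  next
    assume *: "\<forall>w\<in>{..Max Z}. n + w \<in> Q \<longleftrightarrow> w \<in> Z"
    have "z \<le> Max Z" if "z \<in> Z" for z using assms that by simp
    moreover have "y \<in> (+) n ` Z" if "y \<in> Q" "n \<le> y" "y \<le> n + Max Z" for y
      using * that by (intro image_eqI[of _ _ "y - n"]) auto
    ultimately show "(+) n ` Z = Q \<inter> {n..n + Max Z}"
      using * by auto
  qed
  ultimately show ?thesis by simp
qed

lemma Legendre_eq_iff:
  assumes "y \<in> {1..p - 1}"
  shows "Legendre (int y) (int p) = 1 \<longleftrightarrow> y \<in> quad_residues p"
    and "Legendre (int y) (int p) = -1 \<longleftrightarrow> y \<in> quad_nonresidues p"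
proof -
  have "\<not> int p dvd int y"
    using assms by (auto dest: dvd_imp_le)
  then show "Legendre (int y) (int p) = 1 \<longleftrightarrow> y \<in> quad_residues p"
    and "Legendre (int y) (int p) = -1 \<longleftrightarrow> y \<in> quad_nonresidues p"
    using assms by (auto simp: Legendre_def cong_0_iff quad_residues_def quad_nonresidues_def)
qed

lemma support_set_translate_iff:
  assumes "finite Z" "0 \<in> Z" "n \<in> {1..<p - Max Z}"
  shows "residue_support_set p ((+) n ` Z) \<longleftrightarrow>
      (\<forall>w\<in>{..Max Z}. Legendre (int (n + w)) (int p) = (if w \<in> Z then 1 else -1))"
    and "nonresidue_support_set p ((+) n ` Z) \<longleftrightarrow>
      (\<forall>w\<in>{..Max Z}. Legendre (int (n + w)) (int p) = (if w \<in> Z then -1 else 1))"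
proof -
  have mem: "n + w \<in> {1..p - 1}" if "w \<in> {..Max Z}" for w
    using that assms(3) by auto
  \<comment> \<open>Within \<open>{1..p - 1}\<close> a number that is not a residue is a
    non-residue, so the offsets outside \<open>Z\<close> receive the opposite sign rather than
    \<open>0\<close>.\<close>
  have cases: "n + w \<in> quad_residues p \<longleftrightarrow> n + w \<notin> quad_nonresidues p" if "w \<in> {..Max Z}" for w
    using mem[OF that] by (auto simp: quad_residues_def quad_nonresidues_def)
  note L = Legendre_eq_iff[OF mem]
  show "residue_support_set p ((+) n ` Z) \<longleftrightarrow>
      (\<forall>w\<in>{..Max Z}. Legendre (int (n + w)) (int p) = (if w \<in> Z then 1 else -1))"
    unfolding residue_support_set_def translate_eq_Int_iff[OF assms(1,2)]
    by (rule ball_cong[OF refl]) (use L cases in auto)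
  show "nonresidue_support_set p ((+) n ` Z) \<longleftrightarrow>
      (\<forall>w\<in>{..Max Z}. Legendre (int (n + w)) (int p) = (if w \<in> Z then -1 else 1))"
    unfolding nonresidue_support_set_def translate_eq_Int_iff[OF assms(1,2)]
    by (rule ball_cong[OF refl]) (use L cases in auto)
qed

section \<open>The theorem for unions of arithmetic progressions\<close>

lemma AP_base_facts:
  assumes "k \<ge> 1" "s \<ge> 1"
  shows "finite (AP_base k b s)" "0 \<in> AP_base k b s"
    "Max (AP_base k b s) = Max (b ` {1..k}) * (s - 1)"
proof -
  show fin: "finite (AP_base k b s)"
    by (simp add: AP_base_def)
  show "0 \<in> AP_base k b s"
    using assms by (auto simp: AP_base_def intro!: bexI[of _ 1])
  show "Max (AP_base k b s) = Max (b ` {1..k}) * (s - 1)"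
  proof (rule Max_eqI[OF fin])
    fix y assume "y \<in> AP_base k b s"
    then obtain i j where "y = i * b j" "i \<le> s - 1" "j \<in> {1..k}"
      by (auto simp: AP_base_def)
    moreover from this have "b j \<le> Max (b ` {1..k})" by simp
    ultimately show "y \<le> Max (b ` {1..k}) * (s - 1)"
      by (metis mult.commute mult_le_mono)
  next
    have "Max (b ` {1..k}) \<in> b ` {1..k}" using assms by (intro Max_in) auto
    then obtain j where "j \<in> {1..k}" "b j = Max (b ` {1..k})" by force
    then show "Max (b ` {1..k}) * (s - 1) \<in> AP_base k b s"
      by (auto simp: AP_base_def intro!: bexI[of _ j] exI[of _ "s - 1"])
  qed
qed

lemma eventually_at_top_odd_primes_pos:
  "eventually P at_top_odd_primes \<Longrightarrow> \<exists>p0>0. \<forall>p\<ge>p0. prime p \<and> odd p \<longrightarrow> P p"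
proof -
  assume "eventually P at_top_odd_primes"
  then obtain N where "\<forall>p\<ge>N. prime p \<and> odd p \<longrightarrow> P p"
    unfolding eventually_at_top_odd_primes by blast
  then show ?thesis
    by (intro exI[of _ "Suc N"]) auto
qed

theorem theorem2p3:
  fixes k s :: nat and b :: "nat \<Rightarrow> nat"
  assumes "k \<ge> 1" and "s \<ge> 1"
    and "\<And>j. j \<in> {1..k} \<Longrightarrow> b j > 0"
    and "inj_on b {1..k}"
  defines "\<gamma> \<equiv> card (AP_base k b s)"
    and "bmax \<equiv> Max (b ` {1..k})"
  shows "universal_pattern_property (AP_base k b s) \<and>
    residue_support_property (AP k b s) \<and>
    nonresidue_support_property (AP k b s) \<and>
    (\<forall>\<epsilon>\<in>sign_choices \<gamma>.
      (\<lambda>p. real (card {S \<in> AP k b s \<inter> Pow {1..p - 1}. residue_pattern (AP_base k b s) S \<epsilon> p}))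
        \<sim>[at_top_odd_primes] (\<lambda>p. real p / 2 ^ \<gamma>)) \<and>
    (\<lambda>p. real (card {S \<in> AP k b s \<inter> Pow {1..p - 1}. residue_support_set p S}))
      \<sim>[at_top_odd_primes] (\<lambda>p. real p / 2 ^ (1 + bmax * (s - 1))) \<and>
    (\<lambda>p. real (card {S \<in> AP k b s \<inter> Pow {1..p - 1}. nonresidue_support_set p S}))
      \<sim>[at_top_odd_primes] (\<lambda>p. real p / 2 ^ (1 + bmax * (s - 1)))"
proof -
  define Z where "Z = AP_base k b s"
  define M where "M = Max Z"
  have Z: "finite Z" "0 \<in> Z" and M: "M = bmax * (s - 1)"
    using AP_base_facts[OF assms(1,2), of b] by (simp_all add: Z_def M_def bmax_def)
  have ZM: "Z \<subseteq> {..M}" using Z(1) by (auto simp: M_def)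
  have card_M: "card {..M} = 1 + bmax * (s - 1)" by (simp add: M)
  have AP: "AP k b s = translates Z" by (simp add: AP_eq_translates Z_def)
  have translateI: "(+) n ` Z \<in> translates Z \<inter> Pow {1..p - 1}" if "n \<in> {1..<p - M}" for n p
    using that translate_subset_iff[OF Z, of n p] by (auto simp: translates_def M_def)
  \<comment> \<open>Common to both support properties: \<open>\<epsilon>\<close> is later one
    constant sign on \<open>Z\<close> and the opposite sign on the rest of
    \<open>{..M}\<close>.\<close>
  have exists: "\<exists>p0>0. \<forall>p\<ge>p0. prime p \<and> odd p \<longrightarrow> (\<exists>S \<in> translates Z \<inter> Pow {1..p - 1}. Q p S)"
    if Q: "\<And>n p. n \<in> {1..<p - M} \<Longrightarrow> Q p ((+) n ` Z) \<longleftrightarrow>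
        (\<forall>w\<in>{..M}. Legendre (int (n + w)) (int p) = \<epsilon> w)" and \<epsilon>: "\<epsilon> \<in> {..M} \<rightarrow> {-1, 1}" for Q \<epsilon>
  proof (rule eventually_at_top_odd_primes_pos)
    show "\<forall>\<^sub>F p in at_top_odd_primes. \<exists>S \<in> translates Z \<inter> Pow {1..p - 1}. Q p S"
      using eventually_pattern_exists[OF order.refl, of M]
    proof eventually_elim
      case (elim p)
      then obtain n where "n \<in> {1..<p - M}" "\<forall>w\<in>{..M}. Legendre (int (n + w)) (int p) = \<epsilon> w"
        using \<epsilon> by blast
      then show ?case
        using Q translateI by blast
    qed
  qed
  have 1: "universal_pattern_property Z"
    unfolding universal_pattern_property_def
  proof (rule eventually_at_top_odd_primes_pos)
    show "\<forall>\<^sub>F p in at_top_odd_primes. \<forall>\<epsilon>\<in>sign_choices (card Z).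
        \<exists>S \<in> translates Z \<inter> Pow {1..p - 1}. residue_pattern Z S \<epsilon> p"
      using eventually_pattern_exists[OF ZM]
    proof eventually_elim
      case (elim p)
      show ?case
      proof
        fix \<epsilon> assume \<epsilon>: "\<epsilon> \<in> sign_choices (card Z)"
        obtain n where n: "n \<in> {1..<p - M}"
          "\<forall>z\<in>Z. Legendre (int (n + z)) (int p) = \<epsilon> (inv_into {1..card Z} (nth_elem Z) z)"
          using bspec[OF elim sign_choices_inv_nth_elem[OF Z(1) \<epsilon>]] by blast
        then have "residue_pattern Z ((+) n ` Z) \<epsilon> p"
          using residue_pattern_translate_iff[OF Z] by simp
        then show "\<exists>S \<in> translates Z \<inter> Pow {1..p - 1}. residue_pattern Z S \<epsilon> p"
          using translateI n(1) by blast
      qed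
    qed
  qed
  have 2: "residue_support_property (translates Z)"
    unfolding residue_support_property_def
    by (rule exists[OF support_set_translate_iff(1)[OF Z, folded M_def]]) auto
  have 3: "nonresidue_support_property (translates Z)"
    unfolding nonresidue_support_property_def
    by (rule exists[OF support_set_translate_iff(2)[OF Z, folded M_def]]) auto
  have 4: "(\<lambda>p. real (card {S \<in> translates Z \<inter> Pow {1..p - 1}. residue_pattern Z S \<epsilon> p}))
      \<sim>[at_top_odd_primes] (\<lambda>p. real p / 2 ^ card Z)" if "\<epsilon> \<in> sign_choices (card Z)" for \<epsilon>
  proof -
    have "card {S \<in> translates Z \<inter> Pow {1..p - 1}. residue_pattern Z S \<epsilon> p}
      = card {n \<in> {1..<p - M}. \<forall>z\<in>Z. Legendre (int (n + z)) (int p) = \<epsilon> (inv_into {1..card Z} (nth_elem Z) z)}" for p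
      unfolding M_def using Z by (intro card_translates residue_pattern_translate_iff) auto
    then show ?thesis
      using card_pattern_asymp[OF ZM sign_choices_inv_nth_elem[OF Z(1) that]] by simp
  qed
  have 5: "(\<lambda>p. real (card {S \<in> translates Z \<inter> Pow {1..p - 1}. residue_support_set p S}))
      \<sim>[at_top_odd_primes] (\<lambda>p. real p / 2 ^ card {..M})"
  proof -
    have "card {S \<in> translates Z \<inter> Pow {1..p - 1}. residue_support_set p S}
      = card {n \<in> {1..<p - M}. \<forall>w\<in>{..M}. Legendre (int (n + w)) (int p) = (if w \<in> Z then 1 else -1)}" for p
      unfolding M_def using Z by (intro card_translates support_set_translate_iff)
    then show ?thesis
      using card_pattern_asymp[of "{..M}" M "\<lambda>w. if w \<in> Z then 1 else -1"] by simp
  qed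
  have 6: "(\<lambda>p. real (card {S \<in> translates Z \<inter> Pow {1..p - 1}. nonresidue_support_set p S}))
      \<sim>[at_top_odd_primes] (\<lambda>p. real p / 2 ^ card {..M})"
  proof -
    have "card {S \<in> translates Z \<inter> Pow {1..p - 1}. nonresidue_support_set p S}
      = card {n \<in> {1..<p - M}. \<forall>w\<in>{..M}. Legendre (int (n + w)) (int p) = (if w \<in> Z then -1 else 1)}" for p
      unfolding M_def using Z by (intro card_translates support_set_translate_iff)
    then show ?thesis
      using card_pattern_asymp[of "{..M}" M "\<lambda>w. if w \<in> Z then -1 else 1"] by simp
  qed
  from 1 2 3 4 5 6 show ?thesis
    unfolding AP \<gamma>_def card_M Z_def[symmetric] by (intro conjI ballI)
qed

end
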